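(* Let $n\geq 1$ be an integer, let $p\in[1,\infty)$, and let $A:\mathbb{R}^n\to\mathbb{R}^n$ be a locally bounded vector field. Then for every $$u\in\bigcup_{0<s<1}D^{s,p}_{A,0}(\mathbb{R}^n,\mathbb{C})$$ there holds $$\lim_{s\searrow 0}\; s\int_{\mathbb{R}^n}\int_{\mathbb{R}^n}\frac{\left|u(x)-e^{\mathrm{i}(x-y)\cdot A\left(\frac{x+y}{2}\right)}u(y)\right|^p}{|x-y|^{n+ps}}\,dx\,dy=\frac{4\pi^{n/2}}{p\,\Gamma(n/2)}\,\|u\|^p_{L^p(\mathbb{R}^n)}.$$
   Context: $\mathrm{i}$ is the imaginary unit, $|\cdot|$ is the usual modulus on $\mathbb{C}$ (and the Euclidean norm on $\mathbb{R}^n$), and $\Gamma$ is the Gamma function. The field $A$ is (Lebesgue measurable and) locally bounded. For $s\in(0,1)$, $D^{s,p}_{A,0}(\mathbb{R}^n,\mathbb{C})$ is the space of complex-valued functions defined as the completion of $C^\infty_c(\mathbb{R}^n,\mathbb{C})$ with respect to the norm $$\|u\|_{D^{s,p}_{A,0}}=\left(\int_{\mathbb{R}^n}\int_{\mathbb{R}^n}\frac{\left|u(x)-e^{\mathrm{i}(x-y)\cdot A\left(\frac{x+y}{2}\right)}u(y)\right|^p}{|x-y|^{n+ps}}\,dx\,dy\right)^{1/p}.$$ The function $u$ is not assumed to lie in $L^p(\mathbb{R}^n)$: the value $+\infty$ is allowed, with $\|u\|_{L^p(\mathbb{R}^n)}=+\infty$ if $u\notin L^p(\mathbb{R}^n)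$.
   Formalization: The completion is realized as measurable functions that are limits in measure of norm-Cauchy sequences of test functions; for sp<n this is the full completion, while for sp≥n, where it may not be a function space and the claim fails (e.g. u=1), only elements having such a limit are covered. *)

theory Defs
  imports "HOL-Analysis.Analysis"
begin

text \<open>Real powers of extended nonnegative numbers; only meant for positive exponents.\<close>

definition enn_powr :: "ennreal \<Rightarrow> real \<Rightarrow> ennreal" where
  "enn_powr x a = (if x = \<infinity> then \<infinity> else ennreal (enn2real x powr a))"

definition Lp_norm :: "real \<Rightarrow> (real ^ 'n \<Rightarrow> complex) \<Rightarrow> ennreal" where
  "Lp_norm p u = enn_powr (\<integral>\<^sup>+x. ennreal (cmod (u x) powr p) \<partial>lebesgue) (1 / p)"

definition locally_bounded :: "('a::metric_space \<Rightarrow> 'b::metric_space) \<Rightarrow> bool" where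
  "locally_bounded f \<longleftrightarrow> (\<forall>x. \<exists>e>0. bounded (f ` ball x e))"

primrec Ck :: "nat \<Rightarrow> ('a::real_normed_vector \<Rightarrow> 'b::real_normed_vector) \<Rightarrow> bool" where
  "Ck 0 f \<longleftrightarrow> continuous_on UNIV f"
| "Ck (Suc k) f \<longleftrightarrow> (\<forall>x. f differentiable (at x)) \<and>
     (\<forall>v. Ck k (\<lambda>x. frechet_derivative f (at x) v))"

definition Cc_infinity :: "('a::real_normed_vector \<Rightarrow> 'b::real_normed_vector) set" where
  "Cc_infinity = {f. (\<forall>k. Ck k f) \<and> compact (closure {x. f x \<noteq> 0})}"

text \<open>On the diagonal \<open>x = y\<close> the integrand below is \<open>0 / 0 = 0\<close>.\<close>

definition magnetic_energy ::
  "(real ^ 'n \<Rightarrow> real ^ 'n) \<Rightarrow> real \<Rightarrow> real \<Rightarrow> (real ^ 'n \<Rightarrow> complex) \<Rightarrow> ennreal" where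
  "magnetic_energy A s p u =
     (\<integral>\<^sup>+y. (\<integral>\<^sup>+x.
        ennreal (cmod (u x - exp (\<i> * of_real ((x - y) \<bullet> A (midpoint x y))) * u y) powr p
                 / norm (x - y) powr (real CARD('n) + p * s))
      \<partial>lebesgue) \<partial>lebesgue)"

definition magnetic_norm ::
  "(real ^ 'n \<Rightarrow> real ^ 'n) \<Rightarrow> real \<Rightarrow> real \<Rightarrow> (real ^ 'n \<Rightarrow> complex) \<Rightarrow> ennreal" where
  "magnetic_norm A s p u = enn_powr (magnetic_energy A s p u) (1 / p)"

definition tendsto_measure ::
  "(nat \<Rightarrow> real ^ 'n \<Rightarrow> complex) \<Rightarrow> (real ^ 'n \<Rightarrow> complex) \<Rightarrow> bool" where
  "tendsto_measure \<phi> u \<longleftrightarrow>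
     (\<forall>e>0. (\<lambda>k. emeasure lebesgue {x. cmod (\<phi> k x - u x) > e}) \<longlonglongrightarrow> 0)"

text \<open>
  The completion of the compactly supported smooth functions, realised as a space of functions: a
  class of Cauchy sequences is identified with the limit in measure of a sequence in that class.
  That limit is unique up to null sets: if \<open>w\<close> has magnetic norm zero, then \<open>|w|\<close> is constant (by
  the diamagnetic inequality), and a nonzero constant is no limit in measure of functions of compact
  support. By Fatou's lemma, different classes have different limits. For \<open>s p < n\<close> the norm dominates the weak \<open>L\<^sup>q\<close>
  quasinorm with \<open>q = n p / (n - s p)\<close> on test functions, so every class has such a limit.

  Convergence almost everywhere or locally in measure would be too weak. For \<open>s p \<ge> n\<close> there are
  test functions converging to the constant 1 pointwise, and (for \<open>A = 0\<close>) to 0 in norm.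
\<close>

definition magnetic_space ::
  "(real ^ 'n \<Rightarrow> real ^ 'n) \<Rightarrow> real \<Rightarrow> real \<Rightarrow> (real ^ 'n \<Rightarrow> complex) set" where
  "magnetic_space A s p = {u. u \<in> borel_measurable lebesgue \<and>
     (\<exists>\<phi>. (\<forall>k. \<phi> k \<in> Cc_infinity) \<and>
          (\<forall>e>0. \<exists>N. \<forall>j\<ge>N. \<forall>k\<ge>N. magnetic_norm A s p (\<lambda>x. \<phi> j x - \<phi> k x) < e) \<and>
          tendsto_measure \<phi> u)}"

end

theory Submission
  imports Defs
begin

text \<open>
  Write \<open>f = |u|\<close>. Only \<open>|x - y| \<ge> R\<close> contributes to the limit: for \<open>s \<le> s0\<close> the rest of the energy is
  at most \<open>R\<^sup>p\<^sup>s\<^sup>0\<close> times the energy of order \<open>s0\<close>, which is finite by Fatou's lemma, and the factor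
  \<open>s\<close> kills it. On the far region the phase disappears, since
  \<open>|f x - f y| \<le> |u x - e\<^sup>i\<^sup>\<theta> u y| \<le> f x + f y\<close>, and \<open>s\<close> times the integral of the kernel tends to
  \<open>\<omega> / p\<close> with \<open>\<omega>\<close> the area of the unit sphere.

  Lower bound: let \<open>g\<close> be \<open>(f - e)\<^sub>+\<close> cut off at a large height. Its support has finite measure, being
  contained in a superlevel set of a limit in measure of functions of compact support, so almost all
  of the kernel mass seen from a point \<open>x\<close> of the support lies where \<open>f \<le> e\<close>, and there
  \<open>|f x - f y| \<ge> g x\<close>. The two orders of \<open>x\<close> and \<open>y\<close> give the factor 2.

  Upper bound for \<open>u\<close> in \<open>L\<^sup>p\<close>: if \<open>|x - y| \<ge> R\<close>, then \<open>x\<close> or \<open>y\<close> has norm at least \<open>R / 2\<close>, so that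
  \<open>min (f x) (f y)\<close> is controlled by the tail of \<open>f\<close>, while
  \<open>(a + b)\<^sup>p \<le> (1 + d)\<^sup>p (a\<^sup>p + b\<^sup>p) + (1 + 1 / d)\<^sup>p (min a b)\<^sup>p\<close>.
\<close>

subsection \<open>Radial integrals and convolutions\<close>

text \<open>Both measures agree on the half-lines \<open>{..a}\<close>, which generate the Borel
  sets and are stable under intersection: the left one gives the volume of the ball of radius
  \<open>a\<close>, and the density on the right is the derivative of that volume, that is, the area
  of the sphere of radius \<open>t\<close>.\<close>

lemma distr_norm_lborel:
  "distr lborel borel (norm :: 'a::euclidean_space \<Rightarrow> real) =
     density lborel (\<lambda>t. ennreal (real DIM('a) * unit_ball_vol (real DIM('a)) * t ^ (DIM('a) - 1))
       * indicator {0..} t)"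
    (is "?M = ?N")
proof (rule measure_eqI_generator_eq[where E = "range (\<lambda>a::real. {..a})" and \<Omega> = UNIV
      and A = "\<lambda>i. {..real i}"])
  show "Int_stable (range (\<lambda>a::real. {..a}))"
    by (auto simp: Int_stable_def intro!: image_eqI[of _ _ "min _ _"])
  have dist: "emeasure ?M {..a}
    = (if a < 0 then 0 else ennreal (unit_ball_vol (real DIM('a)) * a ^ DIM('a)))" for a
  proof -
    have "emeasure ?M {..a} = emeasure lborel (cball (0::'a) a)"
      by (subst emeasure_distr) (auto intro!: arg_cong[where f="emeasure lborel"])
    then show ?thesis
      by (simp add: emeasure_cball)
  qed
  show "emeasure ?M X = emeasure ?N X" if X: "X \<in> range (\<lambda>a::real. {..a})" for X
  proof -
    obtain a where a: "X = {..a}" using X by auto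
    let ?V = "unit_ball_vol (real DIM('a))"
    have "emeasure ?N X = (\<integral>\<^sup>+ t. ennreal (real DIM('a) * ?V * t ^ (DIM('a) - 1))
      * indicator {0..a} t \<partial>lborel)"
      by (subst emeasure_density) (auto simp: a intro!: nn_integral_cong split: split_indicator)
    also have "\<dots> = (if a < 0 then 0 else ennreal (?V * a ^ DIM('a)))"
    proof (cases "a < 0")
      case False
      have "(\<integral>\<^sup>+ t. ennreal (real DIM('a) * ?V * t ^ (DIM('a) - 1)) * indicator {0..a} t \<partial>lborel)
          = ennreal (?V * a ^ DIM('a) - ?V * 0 ^ DIM('a))"
        using False by (intro nn_integral_FTC_Icc) (auto intro!: derivative_eq_intros)
      then show ?thesis using False by simp
    qed auto
    finally show ?thesis using dist[of a] a by simp
  qed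
  show "sets ?M = sigma_sets UNIV (range (\<lambda>a::real. {..a}))"
    "sets ?N = sigma_sets UNIV (range (\<lambda>a::real. {..a}))"
    by (auto simp: borel_eq_atMost)
  show "(\<Union>i. {..real i}) = UNIV"
    by (auto simp: real_arch_simple)
  show "emeasure ?M {..real i} \<noteq> \<infinity>" for i
    using dist[of "real i"] by simp
qed auto

text \<open>Polar coordinates for radial functions, obtained by integrating against the image
  measure of the norm.\<close>

lemma nn_integral_radial:
  fixes f :: "real \<Rightarrow> ennreal"
  assumes [measurable]: "f \<in> borel_measurable borel"
  shows "(\<integral>\<^sup>+ x. f (norm (x::'a::euclidean_space)) \<partial>lborel) =
    (\<integral>\<^sup>+ t. ennreal (real DIM('a) * unit_ball_vol (real DIM('a)) * t ^ (DIM('a) - 1))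
      * indicator {0..} t * f t \<partial>lborel)"
proof -
  have "(\<integral>\<^sup>+ x. f (norm (x::'a)) \<partial>lborel) = (\<integral>\<^sup>+ t. f t \<partial>distr lborel borel (norm :: 'a \<Rightarrow> real))"
    by (subst nn_integral_distr) auto
  then show ?thesis
    unfolding distr_norm_lborel by (subst (asm) nn_integral_density) auto
qed

text \<open>In polar coordinates the integrand becomes a multiple of \<open>t powr (-1 - q)\<close>.
  With \<open>q = p * s\<close> the resulting factor \<open>1 / q\<close> is the blow-up that the
  factor \<open>s\<close> of the theorem balances.\<close>

lemma nn_integral_norm_powr_outside:
  assumes q: "q > 0" and R: "R > 0"
  shows "(\<integral>\<^sup>+ x. ennreal (norm (x::'a::euclidean_space) powr - (real DIM('a) + q))
    * indicator {x. R \<le> norm x} x \<partial>lborel)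
    = ennreal (real DIM('a) * unit_ball_vol (real DIM('a)) * R powr - q / q)"
proof -
  let ?c = "real DIM('a) * unit_ball_vol (real DIM('a))"
  have pw: "t ^ (DIM('a) - 1) * t powr (- (real DIM('a) + q)) = t powr (-1 - q)" if "t \<ge> R" for t
  proof -
    have "t ^ (DIM('a) - 1) = t powr (real DIM('a) - 1)"
      using that R by (subst powr_realpow[symmetric]) (auto simp: of_nat_diff)
    then show ?thesis by (simp add: powr_add[symmetric])
  qed
  have "(\<integral>\<^sup>+ x. ennreal (norm (x::'a) powr - (real DIM('a) + q))
    * indicator {x. R \<le> norm x} x \<partial>lborel)
     = (\<integral>\<^sup>+ x. ennreal (norm (x::'a) powr - (real DIM('a) + q)) * indicator {R..} (norm x) \<partial>lborel)"
    by (intro nn_integral_cong) (auto split: split_indicator)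
  also have "\<dots> = (\<integral>\<^sup>+ t. ennreal (?c * t ^ (DIM('a) - 1)) * indicator {0..} t
    * (ennreal (t powr - (real DIM('a) + q)) * indicator {R..} t) \<partial>lborel)"
    by (rule nn_integral_radial) auto
  also have "\<dots> = (\<integral>\<^sup>+ t. ennreal ?c * (ennreal (t powr (-1 - q)) * indicator {R..} t) \<partial>lborel)"
    using R
    by (intro nn_integral_cong)
      (auto split: split_indicator simp: pw[simplified] ennreal_mult[symmetric] mult.assoc)
  also have "\<dots> = ennreal ?c * (\<integral>\<^sup>+ t. (ennreal (t powr (-1 - q)) * indicator {R..} t) \<partial>lborel)"
    by (intro nn_integral_cmult) auto
  also have "(\<integral>\<^sup>+ t. (ennreal (t powr (-1 - q)) * indicator {R..} t) \<partial>lborel)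
    = ennreal (-(R powr (-1 - q + 1)) / (-1 - q + 1))"
    using q R by (intro nn_integral_has_integral_lebesgue' has_integral_powr_to_inf) auto
  also have "ennreal ?c * \<dots> = ennreal (?c * R powr - q / q)"
    using q by (subst ennreal_mult[symmetric]) auto
  finally show ?thesis .
qed

text \<open>In polar coordinates the integrand becomes a multiple of \<open>t powr (q - 1)\<close>.
  It serves with \<open>q = p * (1 - s)\<close>, for the singularity that remains on the diagonal
  once a Lipschitz bound has been used.\<close>

lemma nn_integral_norm_powr_inside:
  assumes q: "q > 0" and R: "R > 0"
  shows "(\<integral>\<^sup>+ x. ennreal (norm (x::'a::euclidean_space) powr (q - real DIM('a)))
    * indicator {x. norm x \<le> R} x \<partial>lborel)
    = ennreal (real DIM('a) * unit_ball_vol (real DIM('a)) * R powr q / q)"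
proof -
  let ?c = "real DIM('a) * unit_ball_vol (real DIM('a))"
  \<comment> \<open>At \<open>t = 0\<close> both sides vanish, because \<open>0 powr a = 0\<close>
    for every exponent.\<close>
  have pw: "t ^ (DIM('a) - 1) * t powr (q - real DIM('a)) = t powr (q - 1)" if "t \<ge> 0" for t
  proof (cases "t = 0")
    case False
    have "t ^ (DIM('a) - 1) = t powr (real DIM('a) - 1)"
      using that False by (subst powr_realpow[symmetric]) (auto simp: of_nat_diff)
    then show ?thesis by (simp add: powr_add[symmetric])
  qed simp
  have "(\<integral>\<^sup>+ x. ennreal (norm (x::'a) powr (q - real DIM('a)))
    * indicator {x. norm x \<le> R} x \<partial>lborel)
     = (\<integral>\<^sup>+ x. ennreal (norm (x::'a) powr (q - real DIM('a))) * indicator {..R} (norm x) \<partial>lborel)"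
    by (intro nn_integral_cong) (auto split: split_indicator)
  also have "\<dots> = (\<integral>\<^sup>+ t. ennreal (?c * t ^ (DIM('a) - 1)) * indicator {0..} t
    * (ennreal (t powr (q - real DIM('a))) * indicator {..R} t) \<partial>lborel)"
    by (rule nn_integral_radial) auto
  also have "\<dots> = (\<integral>\<^sup>+ t. ennreal ?c * (ennreal (t powr (q - 1)) * indicator {0..R} t) \<partial>lborel)"
    by (intro nn_integral_cong)
      (auto split: split_indicator simp: pw[simplified] ennreal_mult[symmetric] mult.assoc)
  also have "\<dots> = ennreal ?c * (\<integral>\<^sup>+ t. (ennreal (t powr (q - 1)) * indicator {0..R} t) \<partial>lborel)"
    by (intro nn_integral_cmult) auto
  also have "(\<integral>\<^sup>+ t. (ennreal (t powr (q - 1)) * indicator {0..R} t) \<partial>lborel)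
    = ennreal (R powr (q - 1 + 1) / (q - 1 + 1))"
    using q R by (intro nn_integral_has_integral_lebesgue' has_integral_powr_from_0) auto
  also have "ennreal ?c * \<dots> = ennreal (?c * R powr q / q)"
    using q by (subst ennreal_mult[symmetric]) auto
  finally show ?thesis .
qed

text \<open>The Jacobian \<open>\<bar>c\<bar> ^ DIM('a)\<close> is 1; \<open>c = 1\<close> gives
  translations and \<open>c = -1\<close> gives reflections.\<close>

lemma nn_integral_lborel_affine:
  fixes t :: "'a::euclidean_space" and f :: "'a \<Rightarrow> ennreal"
  assumes [measurable]: "f \<in> borel_measurable borel" and c: "\<bar>c\<bar> = 1"
  shows "(\<integral>\<^sup>+ x. f (t + c *\<^sub>R x) \<partial>lborel) = (\<integral>\<^sup>+ x. f x \<partial>lborel)"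
proof -
  have "c \<noteq> 0" using c by auto
  have "(\<integral>\<^sup>+ x. f x \<partial>lborel)
    = (\<integral>\<^sup>+ x. f x \<partial>(density (distr lborel borel (\<lambda>x. t + c *\<^sub>R x)) (\<lambda>_. \<bar>c\<bar>^DIM('a))))"
    using lborel_affine[OF \<open>c \<noteq> 0\<close>, of t] by simp
  also have "\<dots> = (\<integral>\<^sup>+ x. f (t + c *\<^sub>R x) \<partial>lborel)"
    by (simp add: c nn_integral_density nn_integral_distr)
  finally show ?thesis ..
qed

text \<open>An invertible affine map pulls null sets back to null sets. The case of interest is
  \<open>x \<mapsto> midpoint x y\<close> with \<open>y\<close> fixed, where the field is
  evaluated.\<close>

lemma AE_lborel_affine:
  fixes t :: "'a::euclidean_space"
  assumes P: "AE x in lborel. P x" and c: "c \<noteq> 0"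
  shows "AE x in lborel. P (t + c *\<^sub>R x)"
proof -
  obtain N where N: "N \<in> null_sets lborel" "{x. \<not> P x} \<subseteq> N"
    using P by (auto simp: eventually_ae_filter)
  have "AE x in lborel. x \<notin> N" using N(1) by (rule AE_not_in)
  then have "AE x in density (distr lborel borel (\<lambda>x. t + c *\<^sub>R x)) (\<lambda>_. \<bar>c\<bar>^DIM('a)). x \<notin> N"
    by (subst lborel_affine[OF c, of t, symmetric])
  then have "AE x in distr lborel borel (\<lambda>x. t + c *\<^sub>R x). x \<notin> N"
    using c by (subst (asm) AE_density) auto
  then have "AE x in lborel. t + c *\<^sub>R x \<notin> N"
    using N(1) by (subst (asm) AE_distr_iff) auto
  then show ?thesis
    by eventually_elim (use N(2) in auto)
qed

text \<open>Translation invariance handles the inner integral of the first identity. In the second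
  one Tonelli exchanges the integrals, and the kernel is then integrated in \<open>y\<close>, which
  takes a reflection.\<close>

lemma nn_integral_convolution:
  fixes f K :: "'a::euclidean_space \<Rightarrow> ennreal"
  assumes [measurable]: "f \<in> borel_measurable borel" "K \<in> borel_measurable borel"
  shows "(\<integral>\<^sup>+ y. \<integral>\<^sup>+ x. f y * K (x - y) \<partial>lborel \<partial>lborel)
    = (\<integral>\<^sup>+ x. f x \<partial>lborel) * (\<integral>\<^sup>+ x. K x \<partial>lborel)"
    and "(\<integral>\<^sup>+ y. \<integral>\<^sup>+ x. f x * K (x - y) \<partial>lborel \<partial>lborel)
      = (\<integral>\<^sup>+ x. f x \<partial>lborel) * (\<integral>\<^sup>+ x. K x \<partial>lborel)"
proof -
  have 1: "(\<integral>\<^sup>+ x. K (x - y) \<partial>lborel) = (\<integral>\<^sup>+ x. K x \<partial>lborel)" for y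
    using nn_integral_lborel_affine[of K 1 "-y"] by simp
  have 2: "(\<integral>\<^sup>+ x. K (y - x) \<partial>lborel) = (\<integral>\<^sup>+ x. K x \<partial>lborel)" for y
    using nn_integral_lborel_affine[of K "-1" "y"] by simp
  show "(\<integral>\<^sup>+ y. \<integral>\<^sup>+ x. f y * K (x - y) \<partial>lborel \<partial>lborel)
    = (\<integral>\<^sup>+ x. f x \<partial>lborel) * (\<integral>\<^sup>+ x. K x \<partial>lborel)"
    by (simp add: nn_integral_cmult nn_integral_multc 1)
  have "(\<integral>\<^sup>+ y. \<integral>\<^sup>+ x. f x * K (x - y) \<partial>lborel \<partial>lborel)
    = (\<integral>\<^sup>+ x. \<integral>\<^sup>+ y. f x * K (x - y) \<partial>lborel \<partial>lborel)"
    by (rule lborel_pair.Fubini') simp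
  then show "(\<integral>\<^sup>+ y. \<integral>\<^sup>+ x. f x * K (x - y) \<partial>lborel \<partial>lborel)
    = (\<integral>\<^sup>+ x. f x \<partial>lborel) * (\<integral>\<^sup>+ x. K x \<partial>lborel)"
    by (simp add: nn_integral_cmult nn_integral_multc 2)
qed

text \<open>Works coordinate by coordinate from the real-valued case. It replaces \<open>A\<close>
  and \<open>u\<close> by Borel functions, for which the integrand of the energy is jointly
  measurable and Tonelli applies.\<close>

lemma ex_borel_measurable_AE_eq_lebesgue:
  fixes f :: "'a::euclidean_space \<Rightarrow> 'b::euclidean_space"
  assumes f: "f \<in> borel_measurable lebesgue"
  obtains g where "g \<in> borel_measurable borel" "AE x in lborel. f x = g x"
proof -
  have "\<forall>b\<in>Basis. \<exists>g'\<in>borel_measurable lborel. AE x in lborel. f x \<bullet> b = g' x"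
    using f by (intro ballI completion_ex_borel_measurable_real) auto
  then obtain g where g: "\<And>b. b \<in> Basis \<Longrightarrow> g b \<in> borel_measurable lborel"
    "\<And>b. b \<in> Basis \<Longrightarrow> AE x in lborel. f x \<bullet> b = g b x"
    by metis
  show thesis
  proof
    show "(\<lambda>x. \<Sum>b\<in>Basis. g b x *\<^sub>R b) \<in> borel_measurable borel"
      using g(1) by (auto intro!: borel_measurable_sum borel_measurable_scaleR)
    have "AE x in lborel. \<forall>b\<in>Basis. f x \<bullet> b = g b x"
      using g(2) by (intro AE_finite_allI) auto
    then show "AE x in lborel. f x = (\<Sum>b\<in>Basis. g b x *\<^sub>R b)"
      by eventually_elim (metis (no_types, lifting) euclidean_representation sum.cong)
  qed
qed

subsection \<open>Bounds on the energy\<close>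

definition magnetic_quotient ::
  "(real ^ 'n \<Rightarrow> real ^ 'n) \<Rightarrow> real \<Rightarrow> real \<Rightarrow> (real ^ 'n \<Rightarrow> complex) \<Rightarrow> real ^ 'n \<Rightarrow> real ^ 'n \<Rightarrow> real" where
  "magnetic_quotient A s p u x y =
     cmod (u x - exp (\<i> * of_real ((x - y) \<bullet> A (midpoint x y))) * u y) powr p
       / norm (x - y) powr (real CARD('n) + p * s)"

lemma magnetic_energy_lborel:
  "magnetic_energy A s p u = (\<integral>\<^sup>+y. \<integral>\<^sup>+x. ennreal (magnetic_quotient A s p u x y) \<partial>lborel \<partial>lborel)"
  by (simp add: magnetic_energy_def magnetic_quotient_def nn_integral_completion)

lemma magnetic_quotient_nonneg [simp]: "0 \<le> magnetic_quotient A s p u x y"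
  by (simp add: magnetic_quotient_def)

lemma borel_measurable_magnetic_quotient [measurable]:
  assumes [measurable]: "A \<in> borel_measurable borel" "u \<in> borel_measurable borel"
    "f \<in> borel_measurable M" "g \<in> borel_measurable M"
  shows "(\<lambda>z. magnetic_quotient A s p u (f z) (g z)) \<in> borel_measurable M"
proof -
  have [measurable]: "(exp :: complex \<Rightarrow> complex) \<in> borel_measurable borel"
    by (intro borel_measurable_continuous_onI continuous_intros)
  show ?thesis
    unfolding magnetic_quotient_def midpoint_def by measurable
qed

text \<open>Outside a null set of \<open>y\<close> the values of \<open>u\<close> and
  \<open>u'\<close> agree at \<open>y\<close>; for such a \<open>y\<close> the map
  \<open>x \<mapsto> midpoint x y\<close> is affine with factor 1/2, so \<open>A\<close> and
  \<open>A'\<close> agree at the midpoint for almost every \<open>x\<close>.\<close>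

lemma magnetic_energy_cong_AE:
  assumes A: "AE x in lborel. A x = A' x" and u: "AE x in lborel. u x = u' x"
  shows "magnetic_energy A s p u = magnetic_energy A' s p u'"
  unfolding magnetic_energy_lborel
proof (rule nn_integral_cong_AE, use u in eventually_elim, rule nn_integral_cong_AE)
  fix y assume y: "u y = u' y"
  have "AE x in lborel. A ((1/2) *\<^sub>R y + (1/2) *\<^sub>R x) = A' ((1/2) *\<^sub>R y + (1/2) *\<^sub>R x)"
    using A by (rule AE_lborel_affine) simp
  then have "AE x in lborel. A (midpoint x y) = A' (midpoint x y)"
    by (simp add: midpoint_def scaleR_add_right add.commute)
  with u show "AE x in lborel. ennreal (magnetic_quotient A s p u x y)
    = ennreal (magnetic_quotient A' s p u' x y)"
    by eventually_elim (simp add: magnetic_quotient_def y)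
qed

lemma cmod_exp_i_of_real_mult [simp]: "cmod (exp (\<i> * of_real t) * z) = cmod z"
  by (simp add: norm_mult)

lemma magnetic_quotient_le:
  assumes "p \<ge> 0"
  shows "magnetic_quotient A s p (u :: real ^ 'n \<Rightarrow> complex) x y
    \<le> (cmod (u x) + cmod (u y)) powr p * norm (x - y) powr - (real CARD('n) + p * s)"
proof -
  have "cmod (u x - exp (\<i> * of_real ((x - y) \<bullet> A (midpoint x y))) * u y) \<le> cmod (u x) + cmod (u y)"
    by (rule order_trans[OF norm_triangle_ineq4]) simp
  then show ?thesis
    unfolding magnetic_quotient_def powr_minus divide_inverse
    using assms by (intro mult_right_mono powr_mono2) auto
qed

text \<open>The phase has modulus one, so the reverse triangle inequality removes it: this is the
  diamagnetic inequality.\<close>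

lemma magnetic_quotient_ge:
  assumes "p \<ge> 0"
  shows "\<bar>cmod (u x) - cmod (u y)\<bar> powr p * norm (x - y) powr - (real CARD('n) + p * s)
    \<le> magnetic_quotient A s p (u :: real ^ 'n \<Rightarrow> complex) x y"
proof -
  have "\<bar>cmod (u x) - cmod (u y)\<bar>
    \<le> cmod (u x - exp (\<i> * of_real ((x - y) \<bullet> A (midpoint x y))) * u y)"
    using norm_triangle_ineq3[of "u x" "exp (\<i> * of_real ((x - y) \<bullet> A (midpoint x y))) * u y"]
      by simp
  then show ?thesis
    unfolding magnetic_quotient_def powr_minus divide_inverse
    using assms by (intro mult_right_mono powr_mono2) auto
qed

section \<open>The kernel away from the diagonal, and the lower bound\<close>

definition far_kernel :: "real \<Rightarrow> real \<Rightarrow> 'a::euclidean_space \<Rightarrow> ennreal" where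
  "far_kernel q R h = ennreal (norm h powr - (real DIM('a) + q)) * indicator {h. R \<le> norm h} h"

lemma borel_measurable_far_kernel [measurable]: "far_kernel q R \<in> borel_measurable borel"
  unfolding far_kernel_def by measurable

lemma nn_integral_far_kernel:
  assumes "q > 0" "R > 0"
  shows "(\<integral>\<^sup>+ h. far_kernel q R (h::'a::euclidean_space) \<partial>lborel)
    = ennreal (real DIM('a) * unit_ball_vol (real DIM('a)) * R powr - q / q)"
  unfolding far_kernel_def by (rule nn_integral_norm_powr_outside[OF assms])

text \<open>The exponent is negative and the kernel lives on \<open>1 \<le> norm h\<close>. Hence
  its mass over any set is at most the measure of that set, uniformly in \<open>q\<close>.\<close>

lemma far_kernel_le_1:
  assumes "q \<ge> 0"
  shows "far_kernel q 1 h \<le> 1"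
  using powr_mono[of "- (real DIM('a) + q)" 0 "norm h"] assms
  by (auto simp: far_kernel_def split: split_indicator if_splits)

text \<open>A point \<open>x\<close> with \<open>g x > 0\<close> is paired with the points
  \<open>y\<close> of the zero set of \<open>g\<close>, where the difference of the moduli is at
  least \<open>g x\<close>. Dropping the other \<open>y\<close> costs at most \<open>I * m\<close>,
  since the kernel is at most 1. The same holds with \<open>x\<close> and \<open>y\<close>
  exchanged, whence the factors 2. The error does not depend on \<open>s\<close>.\<close>

lemma magnetic_energy_lower_bound:
  fixes u :: "real ^ 'n \<Rightarrow> complex"
  assumes p: "p \<ge> 1" and s: "s > 0"
    and [measurable]: "u \<in> borel_measurable borel" "g \<in> borel_measurable borel"
    and g: "\<And>x. 0 \<le> g x" "\<And>x y. g x > 0 \<Longrightarrow> g y = 0 \<Longrightarrow> g x \<le> cmod (u x) - cmod (u y)"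
  defines "I \<equiv> (\<integral>\<^sup>+ x. ennreal (g x powr p) \<partial>lborel)"
    and "m \<equiv> emeasure lborel {x. g x > 0}"
  shows "2 * I * (\<integral>\<^sup>+ h. far_kernel (p * s) 1 (h :: real ^ 'n) \<partial>lborel)
    \<le> magnetic_energy A s p u + 2 * I * m"
proof -
  define K where "K = (far_kernel (p * s) 1 :: real ^ 'n \<Rightarrow> ennreal)"
  define G where "G x = ennreal (g x powr p)" for x
  define Z where "Z = {x. g x = 0}"
  have [measurable]: "K \<in> borel_measurable borel" "G \<in> borel_measurable borel" "Z \<in> sets borel"
    by (auto simp: K_def G_def[abs_def] Z_def)
  have I: "I = (\<integral>\<^sup>+ x. G x \<partial>lborel)" by (simp add: I_def G_def)
  have m: "m = (\<integral>\<^sup>+ x. indicator (- Z) x \<partial>lborel)"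
    using g(1) by (auto simp: m_def Z_def order.strict_iff_order
      intro!: arg_cong[where f="emeasure lborel"])
  have K1: "K h \<le> 1" for h
    using p s by (auto simp: K_def intro!: far_kernel_le_1)
  have split: "K h \<le> K h * indicator Z z + indicator (- Z) z" for h z
    using K1[of h] by (auto split: split_indicator)
  have "I * (\<integral>\<^sup>+ h. K h \<partial>lborel) = (\<integral>\<^sup>+ y. \<integral>\<^sup>+ x. G x * K (x - y) \<partial>lborel \<partial>lborel)"
    unfolding I by (rule nn_integral_convolution(2)[symmetric]) auto
  also have "\<dots> \<le> (\<integral>\<^sup>+ y. \<integral>\<^sup>+ x. G x * K (x - y) * indicator Z y
    + G x * indicator (- Z) y \<partial>lborel \<partial>lborel)"
  proof (intro nn_integral_mono)
    fix x y show "G x * K (x - y) \<le> G x * K (x - y) * indicator Z y + G x * indicator (- Z) y"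
      using mult_left_mono[OF split[of "x - y" y], of "G x"] by (simp add: algebra_simps)
  qed
  also have "\<dots> = (\<integral>\<^sup>+ y. \<integral>\<^sup>+ x. G x * K (x - y) * indicator Z y \<partial>lborel \<partial>lborel) + I * m"
    by (simp add: nn_integral_add nn_integral_multc nn_integral_cmult m I)
  finally have 1: "I * (\<integral>\<^sup>+ h. K h \<partial>lborel)
    \<le> (\<integral>\<^sup>+ y. \<integral>\<^sup>+ x. G x * K (x - y) * indicator Z y \<partial>lborel \<partial>lborel) + I * m" .
  have "I * (\<integral>\<^sup>+ h. K h \<partial>lborel) = (\<integral>\<^sup>+ y. \<integral>\<^sup>+ x. G y * K (x - y) \<partial>lborel \<partial>lborel)"
    unfolding I by (rule nn_integral_convolution(1)[symmetric]) auto
  also have "\<dots> \<le> (\<integral>\<^sup>+ y. \<integral>\<^sup>+ x. G y * K (x - y) * indicator Z x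
    + G y * indicator (- Z) x \<partial>lborel \<partial>lborel)"
  proof (intro nn_integral_mono)
    fix x y show "G y * K (x - y) \<le> G y * K (x - y) * indicator Z x + G y * indicator (- Z) x"
      using mult_left_mono[OF split[of "x - y" x], of "G y"] by (simp add: algebra_simps)
  qed
  also have "\<dots> = (\<integral>\<^sup>+ y. \<integral>\<^sup>+ x. G y * K (x - y) * indicator Z x \<partial>lborel \<partial>lborel) + I * m"
    by (simp add: nn_integral_add nn_integral_multc nn_integral_cmult m I)
  finally have 2: "I * (\<integral>\<^sup>+ h. K h \<partial>lborel)
    \<le> (\<integral>\<^sup>+ y. \<integral>\<^sup>+ x. G y * K (x - y) * indicator Z x \<partial>lborel \<partial>lborel) + I * m" .
  have "2 * I * (\<integral>\<^sup>+ h. K h \<partial>lborel) = I * (\<integral>\<^sup>+ h. K h \<partial>lborel) + I * (\<integral>\<^sup>+ h. K h \<partial>lborel)"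
    by (simp add: mult_2 distrib_right)
  also have "\<dots> \<le> ((\<integral>\<^sup>+ y. \<integral>\<^sup>+ x. G x * K (x - y) * indicator Z y \<partial>lborel \<partial>lborel)
     + (\<integral>\<^sup>+ y. \<integral>\<^sup>+ x. G y * K (x - y) * indicator Z x \<partial>lborel \<partial>lborel)) + 2 * I * m"
    using add_mono[OF 1 2] by (simp add: mult_2 distrib_right add_ac)
  also have "(\<integral>\<^sup>+ y. \<integral>\<^sup>+ x. G x * K (x - y) * indicator Z y \<partial>lborel \<partial>lborel)
     + (\<integral>\<^sup>+ y. \<integral>\<^sup>+ x. G y * K (x - y) * indicator Z x \<partial>lborel \<partial>lborel)
    = (\<integral>\<^sup>+ y. \<integral>\<^sup>+ x. G x * K (x - y) * indicator Z y
      + G y * K (x - y) * indicator Z x \<partial>lborel \<partial>lborel)"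
    by (simp add: nn_integral_add)
  also have "\<dots> \<le> magnetic_energy A s p u"
    unfolding magnetic_energy_lborel
  proof (intro nn_integral_mono)
    fix x y
    have K_le: "K h \<le> ennreal (norm h powr - (real CARD('n) + p * s))" for h
      by (auto simp: K_def far_kernel_def split: split_indicator)
    have *: "G a * K h \<le> ennreal (\<bar>cmod (u a) - cmod (u b)\<bar> powr p
      * norm h powr - (real CARD('n) + p * s))"
      if "g b = 0" for a b h
    proof (cases "g a > 0")
      case True
      then have "g a powr p \<le> \<bar>cmod (u a) - cmod (u b)\<bar> powr p"
        using g(2)[OF True that] p g(1)[of a] by (intro powr_mono2) auto
      then show ?thesis
        unfolding G_def using K_le[of h]
          by (subst ennreal_mult) (auto intro!: mult_mono ennreal_leI)
    next
      case False
      then show ?thesis using g(1)[of a] by (simp add: G_def)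
    qed
    \<comment> \<open>At most one summand is nonzero, since \<open>G\<close> vanishes on
      \<open>Z\<close>; so both orders fit under a single copy of the energy.\<close>
    have "G x * K (x - y) * indicator Z y + G y * K (x - y) * indicator Z x
      \<le> ennreal (\<bar>cmod (u x) - cmod (u y)\<bar> powr p * norm (x - y) powr - (real CARD('n) + p * s))"
      using *[of y x] *[of x y] p
      by (auto simp: Z_def abs_minus_commute G_def split: split_indicator)
    also have "\<dots> \<le> ennreal (magnetic_quotient A s p u x y)"
      using p by (intro ennreal_leI magnetic_quotient_ge) auto
    finally show "G x * K (x - y) * indicator Z y + G y * K (x - y) * indicator Z x
      \<le> ennreal (magnetic_quotient A s p u x y)" .
  qed
  finally show ?thesis by (simp add: K_def)
qed

text \<open>Let \<open>b\<close> be the smaller number. Either \<open>b \<le> d * a\<close> and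
  \<open>a + b \<le> (1 + d) * a\<close>, or \<open>a < b / d\<close> and
  \<open>a + b \<le> (1 + 1 / d) * b\<close>. The first constant tends to 1 as \<open>d\<close>
  tends to 0, which makes the upper bound sharp in the limit.\<close>

lemma add_powr_le:
  fixes a b d p :: real
  assumes "0 \<le> a" "0 \<le> b" "0 < d" "0 \<le> p"
  shows "(a + b) powr p \<le> (1 + d) powr p * (a powr p + b powr p)
    + (1 + 1 / d) powr p * (min a b) powr p"
proof -
  have *: "(a + b) powr p \<le> (1 + d) powr p * (a powr p + b powr p) + (1 + 1 / d) powr p * b powr p"
    if "b \<le> a" "0 \<le> b" for a b :: real
  proof (cases "b \<le> d * a")
    case True
    have "(a + b) powr p \<le> ((1 + d) * a) powr p"
      using that True assms by (intro powr_mono2) (auto simp: algebra_simps)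
    also have "\<dots> = (1 + d) powr p * a powr p" by (rule powr_mult)
    also have "\<dots> \<le> (1 + d) powr p * (a powr p + b powr p)" by (intro mult_left_mono) auto
    also have "\<dots> \<le> (1 + d) powr p * (a powr p + b powr p) + (1 + 1 / d) powr p * b powr p" by simp
    finally show ?thesis .
  next
    case False
    have "(a + b) powr p \<le> ((1 + 1 / d) * b) powr p"
      using that False assms by (intro powr_mono2) (auto simp: field_simps)
    also have "\<dots> = (1 + 1 / d) powr p * b powr p" by (rule powr_mult)
    also have "\<dots> \<le> (1 + d) powr p * (a powr p + b powr p) + (1 + 1 / d) powr p * b powr p" by simp
    finally show ?thesis .
  qed
  show ?thesis
    using *[of a b] *[of b a] assms by (cases "a \<le> b") (auto simp: min_def add.commute)
qed

text \<open>The case \<open>d = 1\<close>, with the minimum absorbed into the sum. The constant is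
  crude and serves only to show that energies are finite.\<close>

lemma add_powr_le_double:
  fixes a b p :: real
  assumes "0 \<le> a" "0 \<le> b" "0 \<le> p"
  shows "(a + b) powr p \<le> 2 * 2 powr p * (a powr p + b powr p)"
proof -
  have "min a b powr p \<le> a powr p"
    using assms by (intro powr_mono2) auto
  then have "2 powr p * min a b powr p \<le> 2 powr p * (a powr p + b powr p)"
    by (intro mult_left_mono add_increasing2) auto
  then show ?thesis
    using add_powr_le[of a b 1 p] assms by (simp add: algebra_simps)
qed

text \<open>The quotients differ by \<open>norm (x - y) powr (p * (s0 - s))\<close>, which is at
  most \<open>R powr (p * s0)\<close> because \<open>1 \<le> R\<close>. This bound is uniform in
  \<open>s\<close>.\<close>

lemma magnetic_quotient_near:
  assumes "0 < p" "0 < s" "s \<le> s0" "norm (x - y) \<le> R" "1 \<le> R"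
  shows "magnetic_quotient A s p (u :: real ^ 'n \<Rightarrow> complex) x y
    \<le> R powr (p * s0) * magnetic_quotient A s0 p u x y"
proof (cases "x = y")
  case False
  let ?h = "norm (x - y)"
  have "?h powr (p * (s0 - s)) \<le> R powr (p * (s0 - s))"
    using assms by (intro powr_mono2) auto
  also have "\<dots> \<le> R powr (p * s0)"
    using assms by (intro powr_mono mult_left_mono) auto
  finally have "?h powr (p * (s0 - s)) \<le> R powr (p * s0)" .
  then have "?h powr (p * (s0 - s)) * ?h powr - (real CARD('n) + p * s0)
    \<le> R powr (p * s0) * ?h powr - (real CARD('n) + p * s0)"
    by (intro mult_right_mono) auto
  then have *: "?h powr - (real CARD('n) + p * s)
    \<le> R powr (p * s0) * ?h powr - (real CARD('n) + p * s0)"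
    by (simp add: powr_add[symmetric] algebra_simps)
  show ?thesis
    unfolding magnetic_quotient_def divide_inverse powr_minus[symmetric]
    using mult_left_mono[OF *, of "cmod (u x - exp (\<i> * of_real ((x - y) \<bullet> A (midpoint x y)))
      * u y) powr p"]
    by (simp add: mult_ac)
qed (simp add: magnetic_quotient_def)

lemma nn_integral_symmetric_convolution:
  fixes f K :: "'a::euclidean_space \<Rightarrow> ennreal"
  assumes [measurable]: "f \<in> borel_measurable borel" "K \<in> borel_measurable borel"
  shows "(\<integral>\<^sup>+ y. \<integral>\<^sup>+ x. (f x + f y) * K (x - y) \<partial>lborel \<partial>lborel)
    = 2 * (\<integral>\<^sup>+ x. f x \<partial>lborel) * (\<integral>\<^sup>+ x. K x \<partial>lborel)"
  by (simp add: distrib_right nn_integral_add nn_integral_convolution mult_2)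

text \<open>Made for three successive limits: as \<open>s\<close> tends to 0 the factor
  \<open>s\<close> kills the term of order \<open>s0\<close>; as \<open>R\<close> grows the tail
  integral vanishes for \<open>u\<close> in \<open>L^p\<close>; as \<open>d\<close> tends to 0 the
  leading constant becomes 1.\<close>

lemma magnetic_energy_upper_bound:
  fixes u :: "real ^ 'n \<Rightarrow> complex"
  assumes p: "p \<ge> 1" and s: "0 < s" "s \<le> s0" and R: "R \<ge> 1" and d: "d > 0"
    and [measurable]: "u \<in> borel_measurable borel" "A \<in> borel_measurable borel"
  shows "magnetic_energy A s p u \<le> ennreal (R powr (p * s0)) * magnetic_energy A s0 p u
    + 2 * (ennreal ((1 + d) powr p) * (\<integral>\<^sup>+ x. ennreal (cmod (u x) powr p) \<partial>lborel)
         + ennreal ((1 + 1 / d) powr p)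
           * (\<integral>\<^sup>+ x. ennreal (cmod (u x) powr p) * indicator {x. R / 2 \<le> norm x} x \<partial>lborel))
      * (\<integral>\<^sup>+ h. far_kernel (p * s) R (h :: real ^ 'n) \<partial>lborel)"
proof -
  \<comment> \<open>The tail of \<open>|u|^p\<close>. If \<open>norm (x - y) > R\<close>, then
    \<open>x\<close> or \<open>y\<close> lies in the tail region, so that \<open>w x + w y\<close>
    dominates the power of the minimum.\<close>
  define w where "w x = (if R / 2 \<le> norm x then cmod (u x) powr p else 0)" for x
  define f where "f x = ennreal ((1 + d) powr p * cmod (u x) powr p
    + (1 + 1 / d) powr p * w x)" for x
  have [measurable]: "w \<in> borel_measurable borel" "f \<in> borel_measurable borel"
    unfolding w_def[abs_def] f_def[abs_def] by measurable
  have w0: "w x \<ge> 0" for x by (simp add: w_def)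
  have "magnetic_energy A s p u
    \<le> (\<integral>\<^sup>+y. \<integral>\<^sup>+x. ennreal (R powr (p * s0)) * ennreal (magnetic_quotient A s0 p u x y)
    + (f x + f y) * far_kernel (p * s) R (x - y) \<partial>lborel \<partial>lborel)"
    unfolding magnetic_energy_lborel
  proof (intro nn_integral_mono)
    fix x y
    show "ennreal (magnetic_quotient A s p u x y)
      \<le> ennreal (R powr (p * s0)) * ennreal (magnetic_quotient A s0 p u x y)
      + (f x + f y) * far_kernel (p * s) R (x - y)"
    proof (cases "norm (x - y) \<le> R")
      case True
      have "ennreal (magnetic_quotient A s p u x y)
        \<le> ennreal (R powr (p * s0)) * ennreal (magnetic_quotient A s0 p u x y)"
        using True magnetic_quotient_near[of p s s0 x y R A u] p s R
        by (subst ennreal_mult[symmetric]) (auto intro!: ennreal_leI)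
      then show ?thesis by (rule order_trans) simp
    next
      case False
      then have "R / 2 \<le> norm x \<or> R / 2 \<le> norm y"
        using norm_triangle_ineq4[of x y] by linarith
      then have "min (cmod (u x)) (cmod (u y)) powr p \<le> w x + w y"
      proof
        assume "R / 2 \<le> norm x"
        then have "min (cmod (u x)) (cmod (u y)) powr p \<le> w x"
          using p by (auto simp: w_def intro!: powr_mono2)
        then show ?thesis using w0[of y] by linarith
      next
        assume "R / 2 \<le> norm y"
        then have "min (cmod (u x)) (cmod (u y)) powr p \<le> w y"
          using p by (auto simp: w_def intro!: powr_mono2)
        then show ?thesis using w0[of x] by linarith
      qed
      then have "(1 + 1 / d) powr p * min (cmod (u x)) (cmod (u y)) powr p
        \<le> (1 + 1 / d) powr p * (w x + w y)"
        by (intro mult_left_mono) auto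
      then have "(cmod (u x) + cmod (u y)) powr p
        \<le> (1 + d) powr p * (cmod (u x) powr p + cmod (u y) powr p)
        + (1 + 1 / d) powr p * (w x + w y)"
        using add_powr_le[of "cmod (u x)" "cmod (u y)" d p] p d by auto
      then have "ennreal ((cmod (u x) + cmod (u y)) powr p) \<le> f x + f y"
        unfolding f_def using w0 by (subst ennreal_plus[symmetric])
          (auto intro!: ennreal_leI simp: algebra_simps simp del: ennreal_plus)
      then have "ennreal ((cmod (u x) + cmod (u y)) powr p)
        * ennreal (norm (x - y) powr - (real CARD('n) + p * s))
        \<le> (f x + f y) * far_kernel (p * s) R (x - y)"
        using False by (intro mult_mono) (auto simp: far_kernel_def)
      moreover have "ennreal (magnetic_quotient A s p u x y)
        \<le> ennreal ((cmod (u x) + cmod (u y)) powr p)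
        * ennreal (norm (x - y) powr - (real CARD('n) + p * s))"
        using magnetic_quotient_le[of p A s u x y] p
        by (subst ennreal_mult[symmetric]) (auto intro!: ennreal_leI)
      ultimately show ?thesis
        by (intro add_increasing) auto
    qed
  qed
  also have "\<dots> = ennreal (R powr (p * s0)) * magnetic_energy A s0 p u +
     2 * (\<integral>\<^sup>+ x. f x \<partial>lborel) * (\<integral>\<^sup>+ h. far_kernel (p * s) R (h :: real ^ 'n) \<partial>lborel)"
    by (simp add: nn_integral_add nn_integral_cmult magnetic_energy_lborel nn_integral_symmetric_convolution)
  also have "(\<integral>\<^sup>+ x. f x \<partial>lborel) = (\<integral>\<^sup>+ x. ennreal ((1 + d) powr p) * ennreal (cmod (u x) powr p)
     + ennreal ((1 + 1 / d) powr p)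
       * (ennreal (cmod (u x) powr p) * indicator {x. R / 2 \<le> norm x} x) \<partial>lborel)"
    by (intro nn_integral_cong) (auto simp: f_def w_def ennreal_mult split: split_indicator)
  also have "\<dots> = ennreal ((1 + d) powr p) * (\<integral>\<^sup>+ x. ennreal (cmod (u x) powr p) \<partial>lborel)
         + ennreal ((1 + 1 / d) powr p)
           * (\<integral>\<^sup>+ x. ennreal (cmod (u x) powr p) * indicator {x. R / 2 \<le> norm x} x \<partial>lborel)"
    by (simp add: nn_integral_add nn_integral_cmult)
  finally show ?thesis .
qed

subsection \<open>Test functions\<close>

text \<open>Finitely many of the balls on which \<open>A\<close> is bounded cover
  \<open>S\<close>.\<close>

lemma locally_bounded_imp_bounded_compact:
  fixes A :: "'a::metric_space \<Rightarrow> 'b::metric_space"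
  assumes "locally_bounded A" "compact S"
  shows "bounded (A ` S)"
proof -
  obtain e where e: "\<And>x. e x > 0" "\<And>x. bounded (A ` ball x (e x))"
    using assms(1) unfolding locally_bounded_def by metis
  obtain C where C: "C \<subseteq> S" "finite C" "S \<subseteq> (\<Union>c\<in>C. ball c (e c))"
    using compactE_image[OF assms(2), of S "\<lambda>c. ball c (e c)"] e(1) by force
  have "bounded (\<Union>c\<in>C. A ` ball c (e c))"
    using C(2) e(2) by auto
  moreover have "A ` S \<subseteq> (\<Union>c\<in>C. A ` ball c (e c))"
    using image_mono[OF C(3), of A] by (simp only: image_UN)
  ultimately show ?thesis
    by (rule bounded_subset)
qed

text \<open>\<open>Ck 1\<close> makes the derivative continuous in each fixed direction. On the
  compact set the basis directions have bounds \<open>B b\<close>, and their sum bounds the operator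
  norm; the mean value inequality on the convex set then gives the Lipschitz constant.\<close>

lemma C1_imp_lipschitz_on_compact_convex:
  fixes f :: "'a::euclidean_space \<Rightarrow> 'b::real_normed_vector"
  assumes "Ck 1 f" "compact S" "convex S"
  obtains L where "L \<ge> 0" "\<And>x y. x \<in> S \<Longrightarrow> y \<in> S \<Longrightarrow> norm (f x - f y) \<le> L * norm (x - y)"
proof -
  have *: "(\<forall>x. f differentiable (at x)) \<and> (\<forall>v. continuous_on UNIV (\<lambda>x. frechet_derivative f (at x) v))"
    using assms(1) unfolding One_nat_def Ck.simps .
  then have diff: "f differentiable at x" for x
    by blast
  have cont: "continuous_on S (\<lambda>x. frechet_derivative f (at x) v)" for v
    using * continuous_on_subset by blast
  have "\<forall>b. \<exists>B. \<forall>x\<in>S. norm (frechet_derivative f (at x) b) \<le> B"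
  proof
    fix b
    have "compact ((\<lambda>x. frechet_derivative f (at x) b) ` S)"
      using cont assms(2) by (rule compact_continuous_image)
    then have "bounded ((\<lambda>x. frechet_derivative f (at x) b) ` S)"
      by (rule compact_imp_bounded)
    then show "\<exists>B. \<forall>x\<in>S. norm (frechet_derivative f (at x) b) \<le> B"
      by (simp add: bounded_iff)
  qed
  from choice[OF this] obtain B where B: "\<And>b x. x \<in> S \<Longrightarrow> norm (frechet_derivative f (at x) b) \<le> B b"
    by blast
  define L where "L = (\<Sum>b\<in>Basis. max 0 (B b))"
  have onorm: "onorm (frechet_derivative f (at x)) \<le> L" if "x \<in> S" for x
  proof (rule onorm_le)
    fix v :: 'a
    interpret linear "frechet_derivative f (at x)"
      using diff by (rule linear_frechet_derivative)
    have "frechet_derivative f (at x) v = frechet_derivative f (at x) (\<Sum>b\<in>Basis. (v \<bullet> b) *\<^sub>R b)"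
      by (simp only: euclidean_representation)
    also have "\<dots> = (\<Sum>b\<in>Basis. (v \<bullet> b) *\<^sub>R frechet_derivative f (at x) b)"
      by (simp only: sum scale)
    finally have "norm (frechet_derivative f (at x) v)
      = norm (\<Sum>b\<in>Basis. (v \<bullet> b) *\<^sub>R frechet_derivative f (at x) b)"
      by (rule arg_cong)
    also have "\<dots> \<le> (\<Sum>b\<in>Basis. \<bar>v \<bullet> b\<bar> * norm (frechet_derivative f (at x) b))"
      by (rule order_trans[OF norm_sum]) simp
    also have "\<dots> \<le> (\<Sum>b\<in>Basis. norm v * max 0 (B b))"
    proof (intro sum_mono mult_mono)
      fix b :: 'a assume "b \<in> Basis"
      then show "\<bar>v \<bullet> b\<bar> \<le> norm v" by (rule Basis_le_norm)
      show "norm (frechet_derivative f (at x) b) \<le> max 0 (B b)" using B[OF that, of b] by linarith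
    qed auto
    finally show "norm (frechet_derivative f (at x) v) \<le> L * norm v"
      by (simp add: L_def sum_distrib_left mult.commute)
  qed
  have der: "(f has_derivative frechet_derivative f (at x)) (at x within S)" for x
    by (rule has_derivative_at_withinI[OF diff[unfolded frechet_derivative_works]])
  show thesis
  proof (rule that)
    show "L \<ge> 0"
      by (simp add: L_def sum_nonneg)
    show "norm (f x - f y) \<le> L * norm (x - y)" if "x \<in> S" "y \<in> S" for x y
      by (rule differentiable_bound[OF assms(3) der onorm that])
  qed
qed

lemma Cc_infinity_continuous: "f \<in> Cc_infinity \<Longrightarrow> continuous_on UNIV f"
  by (metis (no_types, lifting) Cc_infinity_def Ck.simps(1) mem_Collect_eq)

lemma Cc_infinity_measurable:
  fixes f :: "'a::euclidean_space \<Rightarrow> 'b::euclidean_space"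
  shows "f \<in> Cc_infinity \<Longrightarrow> f \<in> borel_measurable borel"
  by (intro borel_measurable_continuous_onI Cc_infinity_continuous)

lemma Cc_infinity_bounds:
  fixes f :: "'a::euclidean_space \<Rightarrow> 'b::euclidean_space"
  assumes "f \<in> Cc_infinity"
  obtains r B where "r > 0" "\<And>x. f x \<noteq> 0 \<Longrightarrow> norm x \<le> r" "B \<ge> 0" "\<And>x. norm (f x) \<le> B"
proof -
  have c: "compact (closure {x. f x \<noteq> 0})" using assms by (auto simp: Cc_infinity_def)
  then obtain r where r: "r > 0" "\<And>x. x \<in> closure {x. f x \<noteq> 0} \<Longrightarrow> norm x \<le> r"
    using bounded_pos[of "closure {x. f x \<noteq> 0}"] by (auto dest: compact_imp_bounded)
  have "compact (f ` closure {x. f x \<noteq> 0})"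
    using Cc_infinity_continuous[OF assms] c
    by (intro compact_continuous_image) (auto intro: continuous_on_subset)
  then obtain B where B: "B > 0" "\<And>x. x \<in> closure {x. f x \<noteq> 0} \<Longrightarrow> norm (f x) \<le> B"
    using bounded_pos[of "f ` closure {x. f x \<noteq> 0}"] by (auto dest: compact_imp_bounded)
  show thesis
  proof
    show "norm x \<le> r" if "f x \<noteq> 0" for x
      using that closure_subset[of "{x. f x \<noteq> 0}"] by (intro r) auto
    show "norm (f x) \<le> B" for x
    proof (cases "f x = 0")
      case False
      then show ?thesis using closure_subset[of "{x. f x \<noteq> 0}"] by (intro B) auto
    qed (use B in auto)
  qed (use r B in auto)
qed

lemma cmod_exp_i_minus_1_le: "cmod (1 - exp (\<i> * of_real t)) \<le> \<bar>t\<bar>"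
proof -
  have "cmod (1 - exp (\<i> * of_real t)) = 2 * \<bar>sin (t / 2)\<bar>"
    by (subst norm_minus_commute) (rule dist_exp_i_1)
  also have "\<dots> \<le> 2 * \<bar>t / 2\<bar>"
    by (intro mult_left_mono abs_sin_x_le_abs_x) auto
  finally show ?thesis by simp
qed

text \<open>Near the diagonal the numerator is at most \<open>(M * norm (x - y)) powr p\<close>,
  which leaves the exponent \<open>p * (1 - s) - n\<close>, integrable at 0 since
  \<open>s < 1\<close>. Away from it the triangle inequality and the integrable far kernel
  suffice.\<close>

lemma magnetic_energy_test_function_finite:
  fixes f :: "real ^ 'n \<Rightarrow> complex"
  assumes f: "f \<in> Cc_infinity" and A: "locally_bounded A" and p: "p \<ge> 1" and s: "0 < s" "s < 1"
  shows "magnetic_energy A s p f < \<infinity>"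
proof -
  obtain r B where r: "r > 0" "\<And>x. f x \<noteq> 0 \<Longrightarrow> norm x \<le> r" and B: "B \<ge> 0" "\<And>x. cmod (f x) \<le> B"
    by (rule Cc_infinity_bounds[OF f]) (rule that)
  have [measurable]: "f \<in> borel_measurable borel" using f by (rule Cc_infinity_measurable)
  \<comment> \<open>The margin 1 is the width of the near region: if
    \<open>norm (x - y) \<le> 1\<close> and \<open>f\<close> is nonzero at one of the points, then
    both points and, by convexity, their midpoint lie in this ball.\<close>
  let ?S = "cball 0 (r + 1) :: (real ^ 'n) set"
  have "Ck 1 f" using f by (simp add: Cc_infinity_def)
  then obtain L where L: "L \<ge> 0" "\<And>x y. x \<in> ?S \<Longrightarrow> y \<in> ?S \<Longrightarrow> cmod (f x - f y) \<le> L * norm (x - y)"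
    by (rule C1_imp_lipschitz_on_compact_convex[OF _ compact_cball convex_cball]) (rule that)
  have "bounded (A ` ?S)"
    using A by (rule locally_bounded_imp_bounded_compact) simp
  then obtain a where a: "a > 0" "\<And>x. x \<in> ?S \<Longrightarrow> norm (A x) \<le> a"
    unfolding bounded_pos by blast
  \<comment> \<open>\<open>L\<close> controls the variation of \<open>f\<close>, and
    \<open>a * B\<close> that of the phase multiplied by the bound on \<open>f\<close>.\<close>
  define M where "M = L + a * B"
  have M: "M \<ge> 0" using L a B by (simp add: M_def)
  define N :: "real ^ 'n \<Rightarrow> ennreal" where
    "N h = ennreal (norm h powr (p * (1 - s) - real CARD('n))) * indicator {h. norm h \<le> 1} h" for h
  define F where "F x = ennreal (2 * 2 powr p * cmod (f x) powr p)" for x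
  define G :: "real ^ 'n \<Rightarrow> ennreal" where "G x = ennreal (M powr p) * indicator ?S x" for x
  have [measurable]: "N \<in> borel_measurable borel" "F \<in> borel_measurable borel"
    unfolding N_def[abs_def] F_def[abs_def] by measurable
  have [measurable]: "G \<in> borel_measurable borel"
    unfolding G_def[abs_def]
    by (intro borel_measurable_times_ennreal borel_measurable_const borel_measurable_indicator) simp
  have "magnetic_energy A s p f
    \<le> (\<integral>\<^sup>+y. \<integral>\<^sup>+x. G y * N (x - y) + (F x + F y) * far_kernel (p * s) 1 (x - y) \<partial>lborel \<partial>lborel)"
    unfolding magnetic_energy_lborel
  proof (intro nn_integral_mono)
    fix x y
    let ?e = "exp (\<i> * of_real ((x - y) \<bullet> A (midpoint x y)))"
    show "ennreal (magnetic_quotient A s p f x y)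
      \<le> G y * N (x - y) + (F x + F y) * far_kernel (p * s) 1 (x - y)"
    proof (cases "norm (x - y) \<le> 1")
      case True
      have "ennreal (magnetic_quotient A s p f x y) \<le> G y * N (x - y)"
      proof (cases "f x = 0 \<and> f y = 0 \<or> x = y")
        case True
        then show ?thesis using p by (auto simp: magnetic_quotient_def)
      next
        case False
        have "norm x \<le> r \<or> norm y \<le> r" using False r(2) by auto
        moreover have "norm x \<le> norm y + 1" "norm y \<le> norm x + 1"
          using True norm_triangle_ineq3[of x y] by auto
        ultimately have xy: "x \<in> ?S" "y \<in> ?S" by auto
        have "midpoint x y \<in> ?S"
          by (rule subsetD[OF closed_segment_subset[OF xy convex_cball] midpoint_in_closed_segment])
        then have am: "norm (A (midpoint x y)) \<le> a" by (rule a)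
        \<comment> \<open>Each of the two terms contributes one factor
          \<open>norm (x - y)\<close>.\<close>
        have "f x - ?e * f y = (f x - f y) + (1 - ?e) * f y" by (simp add: algebra_simps)
        then have "cmod (f x - ?e * f y) \<le> cmod (f x - f y) + cmod (1 - ?e) * cmod (f y)"
          using norm_triangle_ineq[of "f x - f y" "(1 - ?e) * f y"] by (simp only: norm_mult)
        also have "\<dots> \<le> L * norm (x - y) + (norm (x - y) * a) * B"
        proof (intro add_mono mult_mono)
          show "cmod (f x - f y) \<le> L * norm (x - y)" using L xy by auto
          have "cmod (1 - ?e) \<le> \<bar>(x - y) \<bullet> A (midpoint x y)\<bar>" by (rule cmod_exp_i_minus_1_le)
          also have "\<dots> \<le> norm (x - y) * norm (A (midpoint x y))" by (rule Cauchy_Schwarz_ineq2)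
          also have "\<dots> \<le> norm (x - y) * a" using am by (intro mult_left_mono) auto
          finally show "cmod (1 - ?e) \<le> norm (x - y) * a" .
        qed (use B a in auto)
        also have "\<dots> = M * norm (x - y)" by (simp add: M_def algebra_simps)
        finally have "cmod (f x - ?e * f y) powr p \<le> (M * norm (x - y)) powr p"
          using p by (intro powr_mono2) auto
        then have "magnetic_quotient A s p f x y
          \<le> (M * norm (x - y)) powr p / norm (x - y) powr (real CARD('n) + p * s)"
          unfolding magnetic_quotient_def by (intro divide_right_mono) auto
        also have "\<dots> = M powr p * norm (x - y) powr (p * (1 - s) - real CARD('n))"
        proof -
          have "p * (1 - s) - real CARD('n) = p - (real CARD('n) + p * s)"
            by (simp add: algebra_simps)
          then show ?thesis by (simp only: powr_mult powr_diff times_divide_eq_right)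
        qed
        finally show ?thesis
          using xy True by (auto simp: G_def N_def ennreal_mult[symmetric] intro!: ennreal_leI)
      qed
      then show ?thesis by (rule order_trans) simp
    next
      case False
      have "(cmod (f x) + cmod (f y)) powr p
        \<le> 2 * 2 powr p * cmod (f x) powr p + 2 * 2 powr p * cmod (f y) powr p"
        using add_powr_le_double[of "cmod (f x)" "cmod (f y)" p] p by (simp add: algebra_simps)
      then have "ennreal ((cmod (f x) + cmod (f y)) powr p) \<le> F x + F y"
        unfolding F_def by (subst ennreal_plus[symmetric])
          (auto intro!: ennreal_leI simp del: ennreal_plus)
      then have "ennreal ((cmod (f x) + cmod (f y)) powr p)
        * ennreal (norm (x - y) powr - (real CARD('n) + p * s))
        \<le> (F x + F y) * far_kernel (p * s) 1 (x - y)"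
        using False by (intro mult_mono) (auto simp: far_kernel_def)
      moreover have "ennreal (magnetic_quotient A s p f x y)
        \<le> ennreal ((cmod (f x) + cmod (f y)) powr p)
        * ennreal (norm (x - y) powr - (real CARD('n) + p * s))"
        using magnetic_quotient_le[of p A s f x y] p
        by (subst ennreal_mult[symmetric]) (auto intro!: ennreal_leI)
      ultimately show ?thesis
        by (intro add_increasing) auto
    qed
  qed
  also have "\<dots> = (\<integral>\<^sup>+ x. G x \<partial>lborel) * (\<integral>\<^sup>+ x. N x \<partial>lborel)
      + 2 * (\<integral>\<^sup>+ x. F x \<partial>lborel) * (\<integral>\<^sup>+ h. far_kernel (p * s) 1 (h :: real ^ 'n) \<partial>lborel)"
    by (simp add: nn_integral_add flip: nn_integral_convolution(1) nn_integral_symmetric_convolution)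
  also have "\<dots> < \<infinity>"
  proof -
    have "(\<integral>\<^sup>+ x. G x \<partial>lborel) < \<infinity>"
      using emeasure_lborel_cball_finite[of "0 :: real ^ 'n" "r + 1"]
      by (simp add: G_def nn_integral_cmult_indicator ennreal_mult_less_top)
    moreover have "(\<integral>\<^sup>+ x. N x \<partial>lborel) < \<infinity>"
      unfolding N_def using nn_integral_norm_powr_inside[where 'a
        = "real ^ 'n", of "p * (1 - s)" 1] p s by simp
    moreover have "(\<integral>\<^sup>+ h. far_kernel (p * s) 1 (h :: real ^ 'n) \<partial>lborel) < \<infinity>"
      using p s by (subst nn_integral_far_kernel) auto
    moreover have "(\<integral>\<^sup>+ x. F x \<partial>lborel) < \<infinity>"
    proof -
      have "(\<integral>\<^sup>+ x. F x \<partial>lborel)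
        \<le> (\<integral>\<^sup>+ x. ennreal (2 * 2 powr p * B powr p)
        * indicator (cball (0 :: real ^ 'n) r) x \<partial>lborel)"
        using B r p by (intro nn_integral_mono)
          (auto simp: F_def split: split_indicator intro!: ennreal_leI powr_mono2)
      also have "\<dots> < \<infinity>"
        using emeasure_lborel_cball_finite[of "0 :: real ^ 'n" r]
        by (simp add: nn_integral_cmult_indicator ennreal_mult_less_top)
      finally show ?thesis .
    qed
    ultimately show ?thesis by (simp add: ennreal_mult_less_top)
  qed
  finally show ?thesis .
qed

subsection \<open>The completion\<close>

text \<open>The phase does not depend on \<open>j\<close>, so the quotients converge wherever both
  values do. Fatou's lemma is applied in \<open>x\<close> for almost every fixed \<open>y\<close>,
  and then in \<open>y\<close>.\<close>

lemma magnetic_energy_fatou: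
  assumes p: "p \<ge> 1" and [measurable]: "A \<in> borel_measurable borel" "w \<in> borel_measurable borel"
    "\<And>j. f j \<in> borel_measurable borel"
    and lim: "AE x in lborel. (\<lambda>j. f j x) \<longlonglongrightarrow> w x"
  shows "magnetic_energy A s p w \<le> liminf (\<lambda>j. magnetic_energy A s p (f j))"
proof -
  have "magnetic_energy A s p w
    \<le> (\<integral>\<^sup>+y. liminf (\<lambda>j. \<integral>\<^sup>+x. ennreal (magnetic_quotient A s p (f j) x y) \<partial>lborel) \<partial>lborel)"
    unfolding magnetic_energy_lborel
  proof (rule nn_integral_mono_AE, use lim in eventually_elim)
    fix y assume y: "(\<lambda>j. f j y) \<longlonglongrightarrow> w y"
    have "(\<integral>\<^sup>+ x. ennreal (magnetic_quotient A s p w x y) \<partial>lborel)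
      = (\<integral>\<^sup>+ x. liminf (\<lambda>j. ennreal (magnetic_quotient A s p (f j) x y)) \<partial>lborel)"
    proof (rule nn_integral_cong_AE, use lim in eventually_elim)
      fix x assume x: "(\<lambda>j. f j x) \<longlonglongrightarrow> w x"
      have "(\<lambda>j. magnetic_quotient A s p (f j) x y) \<longlonglongrightarrow> magnetic_quotient A s p w x y"
        unfolding magnetic_quotient_def divide_inverse
        using p by (intro tendsto_mult_right tendsto_powr' tendsto_norm tendsto_diff tendsto_mult_left tendsto_const x y) auto
      then have "(\<lambda>j. ennreal (magnetic_quotient A s p (f j) x y))
        \<longlonglongrightarrow> ennreal (magnetic_quotient A s p w x y)"
        by (rule tendsto_ennrealI)
      then show "ennreal (magnetic_quotient A s p w x y)
        = liminf (\<lambda>j. ennreal (magnetic_quotient A s p (f j) x y))"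
        by (intro lim_imp_Liminf[symmetric]) auto
    qed
    also have "\<dots> \<le> liminf (\<lambda>j. \<integral>\<^sup>+x. ennreal (magnetic_quotient A s p (f j) x y) \<partial>lborel)"
      by (intro nn_integral_liminf) measurable
    finally show "(\<integral>\<^sup>+ x. ennreal (magnetic_quotient A s p w x y) \<partial>lborel) \<le> \<dots>" .
  qed
  also have "\<dots> \<le> liminf (\<lambda>j. magnetic_energy A s p (f j))"
    unfolding magnetic_energy_lborel by (intro nn_integral_liminf) measurable
  finally show ?thesis .
qed

text \<open>For fixed \<open>x\<close> and \<open>y\<close> the magnetic difference is linear in the
  function, so a bound for the power of a sum suffices.\<close>

lemma magnetic_energy_add:
  fixes u v :: "real ^ 'n \<Rightarrow> complex"
  assumes p: "p \<ge> 1" and [measurable]: "A \<in> borel_measurable borel" "u \<in> borel_measurable borel"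
    "v \<in> borel_measurable borel"
  shows "magnetic_energy A s p (\<lambda>x. u x + v x)
    \<le> ennreal (2 * 2 powr p) * (magnetic_energy A s p u + magnetic_energy A s p v)"
proof -
  have "magnetic_energy A s p (\<lambda>x. u x + v x) \<le> (\<integral>\<^sup>+y. \<integral>\<^sup>+x. ennreal (2 * 2 powr p) *
    (ennreal (magnetic_quotient A s p u x y)
      + ennreal (magnetic_quotient A s p v x y)) \<partial>lborel \<partial>lborel)"
    unfolding magnetic_energy_lborel
  proof (intro nn_integral_mono)
    fix x y
    let ?e = "exp (\<i> * of_real ((x - y) \<bullet> A (midpoint x y)))"
    let ?a = "u x - ?e * u y" and ?b = "v x - ?e * v y"
    have "cmod (?a + ?b) powr p \<le> (cmod ?a + cmod ?b) powr p"
      using p by (intro powr_mono2 norm_triangle_ineq) auto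
    also have "\<dots> \<le> 2 * 2 powr p * (cmod ?a powr p + cmod ?b powr p)"
      using p by (intro add_powr_le_double) auto
    finally have "cmod (u x + v x - ?e * (u y + v y)) powr p
      \<le> 2 * 2 powr p * (cmod ?a powr p + cmod ?b powr p)"
      by (simp add: algebra_simps)
    then have "magnetic_quotient A s p (\<lambda>x. u x + v x) x y
      \<le> 2 * 2 powr p * (cmod ?a powr p + cmod ?b powr p) / norm (x - y) powr (real CARD('n)
      + p * s)"
      unfolding magnetic_quotient_def by (rule divide_right_mono) simp
    also have "\<dots> = 2 * 2 powr p * (magnetic_quotient A s p u x y + magnetic_quotient A s p v x y)"
      unfolding magnetic_quotient_def divide_inverse
        by (simp only: distrib_left distrib_right mult.assoc)
    finally have "ennreal (magnetic_quotient A s p (\<lambda>x. u x + v x) x y)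
      \<le> ennreal (2 * 2 powr p * (magnetic_quotient A s p u x y + magnetic_quotient A s p v x y))"
      by (rule ennreal_leI)
    also have "\<dots> = ennreal (2 * 2 powr p)
      * (ennreal (magnetic_quotient A s p u x y) + ennreal (magnetic_quotient A s p v x y))"
      by (subst ennreal_mult) (auto simp del: ennreal_mult)
    finally show "ennreal (magnetic_quotient A s p (\<lambda>x. u x + v x) x y) \<le> \<dots>" .
  qed
  also have "\<dots> = ennreal (2 * 2 powr p) * (magnetic_energy A s p u + magnetic_energy A s p v)"
    by (simp add: magnetic_energy_lborel nn_integral_add nn_integral_cmult)
  finally show ?thesis .
qed

lemma enn_powr_less_1_imp:
  assumes "enn_powr x (1 / p) < 1" "p > 0"
  shows "x \<le> 1"
proof (cases x)
  case (real r)
  have "r < 1"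
  proof (rule ccontr)
    assume "\<not> r < 1"
    then have "r powr (1 / p) \<ge> 1" using assms(2) by (intro ge_one_powr_ge_zero) auto
    then show False using assms(1) real by (simp add: enn_powr_def)
  qed
  then show ?thesis using real by simp
qed (use assms(1) in \<open>simp add: enn_powr_def\<close>)

lemma enn_powr_inverse:
  assumes "p > 0"
  shows "enn_powr (enn_powr x (1 / p)) p = x"
  using assms by (cases x) (auto simp: enn_powr_def powr_powr)

section \<open>Consequences of convergence in measure\<close>

lemma tendsto_measure_AE_cong:
  assumes u: "u \<in> borel_measurable lebesgue" "u' \<in> borel_measurable borel"
    and ae: "AE x in lborel. u x = u' x"
    and f: "\<And>k. f k \<in> borel_measurable borel" and lim: "tendsto_measure f u"
  shows "tendsto_measure f u'"
proof -
  have [measurable]: "\<And>k. f k \<in> borel_measurable lebesgue" "u' \<in> borel_measurable lebesgue"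
    "u \<in> borel_measurable lebesgue"
    using u f by (auto intro: measurable_completion)
  have ae': "AE x in lebesgue. u x = u' x" using ae by (rule AE_completion)
  have "emeasure lebesgue {x. e < cmod (f k x - u' x)}
    = emeasure lebesgue {x. e < cmod (f k x - u x)}" for e k
  proof (rule emeasure_eq_AE)
    show "AE x in lebesgue. (x \<in> {x. e < cmod (f k x - u' x)}) = (x \<in> {x. e < cmod (f k x - u x)})"
      using ae' by eventually_elim simp
    have "{x \<in> space lebesgue. e < cmod (f k x - u' x)} \<in> sets lebesgue"
      "{x \<in> space lebesgue. e < cmod (f k x - u x)} \<in> sets lebesgue" by measurable
    then show "{x. e < cmod (f k x - u' x)} \<in> sets lebesgue"
      "{x. e < cmod (f k x - u x)} \<in> sets lebesgue" by auto
  qed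
  then show ?thesis using lim by (simp add: tendsto_measure_def)
qed

text \<open>Borel-Cantelli: \<open>r k\<close> is chosen so that the error exceeds
  \<open>(1/2)^k\<close> only on a set of measure below \<open>(1/2)^k\<close>, and almost every
  point lies in finitely many of these sets. The indices need not increase;
  \<open>k \<le> r k\<close> takes them beyond any given one.\<close>

lemma tendsto_measure_AE_subseq:
  fixes u :: "real ^ 'n \<Rightarrow> complex"
  assumes [measurable]: "u \<in> borel_measurable borel" "\<And>k. f k \<in> borel_measurable borel"
    and lim: "tendsto_measure f u"
  obtains r where "\<And>k::nat. k \<le> r k" "AE x in lborel. (\<lambda>k. f (r k) x) \<longlonglongrightarrow> u x"
proof -
  have lb: "emeasure lebesgue {x. e < cmod (f k x - u x)}
    = emeasure lborel {x. e < cmod (f k x - u x)}" for e k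
  proof -
    have "{x. e < cmod (f k x - u x)} \<in> sets lborel" by measurable
    then show ?thesis by simp
  qed
  have "\<exists>j\<ge>k. emeasure lborel {x. (1/2)^k < cmod (f j x - u x)} < ennreal ((1/2)^k)" for k :: nat
  proof -
    have "(\<lambda>j. emeasure lborel {x. (1/2)^k < cmod (f j x - u x)}) \<longlonglongrightarrow> 0"
      using lim by (simp add: tendsto_measure_def lb)
    then have "eventually (\<lambda>j. emeasure lborel {x. (1/2)^k < cmod (f j x - u x)}
      < ennreal ((1/2)^k)) sequentially"
      by (rule order_tendstoD) simp
    then have "eventually (\<lambda>j. k
      \<le> j \<and> emeasure lborel {x. (1/2)^k < cmod (f j x - u x)} < ennreal ((1/2)^k)) sequentially"
      using eventually_ge_at_top[of k] by eventually_elim simp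
    then show ?thesis by (auto dest: eventually_happens)
  qed
  then obtain r where r: "\<And>k. k \<le> r k"
    "\<And>k. emeasure lborel {x. (1/2)^k < cmod (f (r k) x - u x)} < ennreal ((1/2)^k)"
    by metis
  have "AE x in lborel. eventually (\<lambda>k. x \<in> space lborel - {x. (1/2)^k
    < cmod (f (r k) x - u x)}) sequentially"
  proof (rule borel_cantelli_AE1)
    show "{x. (1/2)^k < cmod (f (r k) x - u x)} \<in> sets lborel" for k by measurable
    show fin: "emeasure lborel {x. (1/2)^k < cmod (f (r k) x - u x)} < \<infinity>" for k
      using r(2)[of k] by (rule less_trans) simp
    show "summable (\<lambda>k. measure lborel {x. (1/2)^k < cmod (f (r k) x - u x)})"
    proof (rule summable_comparison_test)
      show "summable (\<lambda>k. (1/2::real)^k)" by (rule summable_geometric) simp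
      have "measure lborel {x. (1/2)^k < cmod (f (r k) x - u x)} \<le> (1/2)^k" for k
        unfolding measure_def using r(2)[of k] by (intro enn2real_leI) auto
      then show "\<exists>N. \<forall>n\<ge>N. norm (measure lborel {x. (1/2)^n < cmod (f (r n) x - u x)}) \<le> (1/2)^n"
        by auto
    qed
  qed
  then have "AE x in lborel. (\<lambda>k. f (r k) x) \<longlonglongrightarrow> u x"
  proof eventually_elim
    fix x assume "eventually (\<lambda>k. x \<in> space lborel - {x. (1/2)^k
      < cmod (f (r k) x - u x)}) sequentially"
    then have "eventually (\<lambda>k. norm (f (r k) x - u x) \<le> (1/2)^k) sequentially"
      by eventually_elim auto
    moreover have "(\<lambda>k. (1/2::real)^k) \<longlonglongrightarrow> 0" by (rule LIMSEQ_power_zero) simp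
    ultimately have "(\<lambda>k. f (r k) x - u x) \<longlonglongrightarrow> 0"
      by (rule Lim_null_comparison)
    then show "(\<lambda>k. f (r k) x) \<longlonglongrightarrow> u x" by (rule LIM_zero_cancel)
  qed
  then show thesis using r(1) that by blast
qed

text \<open>Choose \<open>k\<close> so that the error exceeds \<open>e\<close> on a set of measure
  below 1. Outside a ball containing the support of \<open>f k\<close> the error is
  \<open>|u|\<close> itself, so the level set lies in the union of that ball and that set.\<close>

lemma tendsto_measure_finite_level_sets:
  fixes u :: "real ^ 'n \<Rightarrow> complex"
  assumes [measurable]: "u \<in> borel_measurable borel" and f: "\<And>k. f k \<in> Cc_infinity"
    and lim: "tendsto_measure f u" and e: "e > 0"
  shows "emeasure lborel {x. e < cmod (u x)} < \<infinity>"
proof -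
  have [measurable]: "f k \<in> borel_measurable borel" for k
    using f by (rule Cc_infinity_measurable)
  have lb: "emeasure lebesgue {x. e < cmod (f k x - u x)}
    = emeasure lborel {x. e < cmod (f k x - u x)}" for k
  proof -
    have "{x. e < cmod (f k x - u x)} \<in> sets lborel" by measurable
    then show ?thesis by simp
  qed
  have "(\<lambda>k. emeasure lborel {x. e < cmod (f k x - u x)}) \<longlonglongrightarrow> 0"
    using lim e by (simp add: tendsto_measure_def lb)
  then have "eventually (\<lambda>k. emeasure lborel {x. e < cmod (f k x - u x)} < 1) sequentially"
    by (rule order_tendstoD) simp
  then obtain k where k: "emeasure lborel {x. e < cmod (f k x - u x)} < 1"
    by (auto dest: eventually_happens)
  obtain r B where r: "\<And>x. f k x \<noteq> 0 \<Longrightarrow> norm x \<le> r"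
    by (rule Cc_infinity_bounds[OF f[of k]]) (rule that)
  have "emeasure lborel {x. e < cmod (u x)}
    \<le> emeasure lborel (cball 0 r \<union> {x. e < cmod (f k x - u x)})"
    using r by (intro emeasure_mono) (auto, force)
  also have "\<dots> \<le> emeasure lborel (cball (0 :: real ^ 'n) r)
    + emeasure lborel {x. e < cmod (f k x - u x)}"
    by (rule emeasure_subadditive) auto
  also have "\<dots> < \<infinity>"
    using k emeasure_lborel_cball_finite[of "0 :: real ^ 'n" r]
      by (auto simp: less_top[symmetric] top_unique intro: less_trans)
  finally show ?thesis .
qed

subsection \<open>The limit\<close>

text \<open>The limit is taken in the extended half-line. Values below it are reached by truncating
  \<open>|u|\<close>, also when \<open>u\<close> is not in \<open>L^p\<close>; values above it exist
  only when \<open>u\<close> is in \<open>L^p\<close>, and then the upper bound applies.\<close>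

lemma magnetic_energy_borel_tendsto:
  fixes A :: "real ^ 'n \<Rightarrow> real ^ 'n" and u :: "real ^ 'n \<Rightarrow> complex"
  assumes p: "1 \<le> p" and [measurable]: "A \<in> borel_measurable borel" "u \<in> borel_measurable borel"
    and s0: "0 < s0" "magnetic_energy A s0 p u < \<infinity>"
    and level: "\<And>e. e > 0 \<Longrightarrow> emeasure lborel {x. e < cmod (u x)} < \<infinity>"
  shows "((\<lambda>s. ennreal s * magnetic_energy A s p u) \<longlongrightarrow>
     ennreal (2 * (real CARD('n) * unit_ball_vol (real CARD('n))) / p)
       * (\<integral>\<^sup>+ x. ennreal (cmod (u x) powr p) \<partial>lborel)) (at_right 0)"
proof -
  define c where "c = 2 * (real CARD('n) * unit_ball_vol (real CARD('n))) / p"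
  define I where "I = (\<integral>\<^sup>+ x. ennreal (cmod (u x) powr p) \<partial>lborel)"
  have c: "c > 0" using p by (simp add: c_def)
  \<comment> \<open>The factor \<open>s\<close> cancels the \<open>1 / (p * s)\<close> in the mass
    of the kernel; \<open>c\<close> is twice the area of the unit sphere divided by
    \<open>p\<close>.\<close>
  have kern: "ennreal s * (2 * (J * (\<integral>\<^sup>+ h. far_kernel (p * s) R (h :: real ^ 'n) \<partial>lborel)))
    = ennreal (c * R powr - (p * s)) * J"
    if "s > 0" "R > 0" for s R J
  proof -
    let ?q = "real CARD('n) * unit_ball_vol (real CARD('n)) * R powr - (p * s) / (p * s)"
    have q: "?q \<ge> 0"
      using that p by simp
    have mult3: "ennreal s * ennreal 2 * ennreal q = ennreal (s * 2 * q)" if "q \<ge> 0" for q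
      using that \<open>s > 0\<close> by (simp add: ennreal_mult)
    have "(\<integral>\<^sup>+ h. far_kernel (p * s) R (h :: real ^ 'n) \<partial>lborel) = ennreal ?q"
      using that p by (subst nn_integral_far_kernel) auto
    then have "ennreal s * (2 * (J * (\<integral>\<^sup>+ h. far_kernel (p * s) R (h :: real ^ 'n) \<partial>lborel)))
        = (ennreal s * ennreal 2 * ennreal ?q) * J"
      by (simp add: mult_ac)
    also have "ennreal s * ennreal 2 * ennreal ?q = ennreal (s * 2 * ?q)"
      using q by (rule mult3)
    also have "s * 2 * ?q = c * R powr - (p * s)"
      using that p by (simp add: c_def field_simps)
    finally show ?thesis .
  qed
  have vanish: "((\<lambda>s. b + ennreal s * B) \<longlongrightarrow> b) (at_right 0)" if "B < \<infinity>" for b B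
  proof -
    obtain B' where B': "B = ennreal B'" "B' \<ge> 0" using \<open>B < \<infinity>\<close> by (cases B) auto
    have "((\<lambda>s. ennreal (s * B')) \<longlongrightarrow> ennreal (0 * B')) (at_right 0)"
      by (intro tendsto_ennrealI tendsto_mult tendsto_const tendsto_ident_at)
    then have "((\<lambda>s. b + ennreal (s * B')) \<longlongrightarrow> b + ennreal (0 * B')) (at_right 0)"
      by (intro tendsto_add tendsto_const)
    moreover have "eventually (\<lambda>s. b + ennreal (s * B') = b + ennreal s * B) (at_right 0)"
      using eventually_at_right_less[of 0] by eventually_elim (simp add: B' ennreal_mult)
    ultimately show ?thesis
      by (subst (asm) tendsto_cong) auto
  qed
  have "((\<lambda>s. ennreal s * magnetic_energy A s p u) \<longlongrightarrow> ennreal c * I) (at_right 0)"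
  proof (rule order_tendstoI)
    fix a assume a: "a < ennreal c * I"
    \<comment> \<open>Subtracting \<open>1 / (k + 1)\<close> makes the support a set of finite
      measure, and the cap \<open>k + 1\<close> then makes the integral of \<open>g k powr p\<close>
      finite. The functions increase to \<open>|u|\<close>, so monotone convergence brings the
      integral close to \<open>I\<close>.\<close>
    define g where "g k x = min (max (cmod (u x) - 1 / (real k + 1)) 0) (real k + 1)" for k :: nat
      and x
    have [measurable]: "g k \<in> borel_measurable borel" for k
      unfolding g_def[abs_def] by measurable
    have g0: "0 \<le> g k x" for k x by (simp add: g_def)
    have "(\<lambda>k. \<integral>\<^sup>+ x. ennreal (g k x powr p) \<partial>lborel) \<longlonglongrightarrow> I"
      unfolding I_def
    proof (rule nn_integral_LIMSEQ)
      show "incseq (\<lambda>k x. ennreal (g k x powr p))"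
      proof (intro incseq_SucI le_funI ennreal_leI powr_mono2)
        fix k x
        have "1 / (real (Suc k) + 1) \<le> 1 / (real k + 1)" by (intro divide_left_mono) auto
        then show "g k x \<le> g (Suc k) x" unfolding g_def by (intro min.mono max.mono) auto
      qed (use p g0 in auto)
      fix x
      have "(\<lambda>k. max (cmod (u x) - 1 / (real k + 1)) 0) \<longlonglongrightarrow> max (cmod (u x) - 0) 0"
        using LIMSEQ_inverse_real_of_nat
        by (intro tendsto_max tendsto_diff tendsto_const) (simp add: inverse_eq_divide add.commute)
      moreover have "eventually (\<lambda>k. max (cmod (u x) - 1 / (real k + 1)) 0 = g k x) sequentially"
        using eventually_ge_at_top[of "nat \<lceil>cmod (u x)\<rceil>"]
      proof eventually_elim
        case (elim k)
        then have "cmod (u x) \<le> real k + 1" by linarith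
        moreover have "0 \<le> 1 / (real k + 1)" by simp
        ultimately have "cmod (u x) - 1 / (real k + 1) \<le> real k + 1" by linarith
        then show ?case by (simp add: g_def)
      qed
      ultimately have "(\<lambda>k. g k x) \<longlonglongrightarrow> cmod (u x)"
        by (subst (asm) tendsto_cong) auto
      then show "(\<lambda>k. ennreal (g k x powr p)) \<longlonglongrightarrow> ennreal (cmod (u x) powr p)"
        using p g0 by (intro tendsto_ennrealI tendsto_powr' tendsto_const) auto
    qed measurable
    then have "(\<lambda>k. ennreal c * (\<integral>\<^sup>+ x. ennreal (g k x powr p) \<partial>lborel)) \<longlonglongrightarrow> ennreal c * I"
      by (intro ennreal_tendsto_cmult) auto
    from order_tendstoD(1)[OF this a] obtain k where
      k: "a < ennreal c * (\<integral>\<^sup>+ x. ennreal (g k x powr p) \<partial>lborel)"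
      by (auto dest: eventually_happens)
    let ?I = "\<integral>\<^sup>+ x. ennreal (g k x powr p) \<partial>lborel" and ?m = "emeasure lborel {x. g k x > 0}"
    have "?m \<le> emeasure lborel {x. 1 / (real k + 1) < cmod (u x)}"
      by (intro emeasure_mono) (auto simp: g_def)
    also have "\<dots> < \<infinity>" by (intro level) simp
    finally have m: "?m < \<infinity>" .
    have "?I \<le> (\<integral>\<^sup>+ x. ennreal ((real k + 1) powr p) * indicator {x. g k x > 0} x \<partial>lborel)"
    proof (rule nn_integral_mono)
      fix x
      show "ennreal (g k x powr p) \<le> ennreal ((real k + 1) powr p) * indicator {x. g k x > 0} x"
      proof (cases "g k x > 0")
        case True
        then show ?thesis using p by (auto intro!: ennreal_leI powr_mono2 simp: g_def)
      qed (use g0[of k x] in auto)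
    qed
    also have "\<dots> < \<infinity>"
      using m by (simp add: nn_integral_cmult_indicator ennreal_mult_less_top)
    finally have fin: "?I < \<infinity>" .
    define B where "B = 2 * ?I * ?m"
    have B: "B < \<infinity>" using fin m by (simp add: B_def ennreal_mult_less_top)
    have low: "ennreal c * ?I \<le> ennreal s * magnetic_energy A s p u + ennreal s * B"
      if "s > 0" for s
    proof -
      have "2 * ?I * (\<integral>\<^sup>+ h. far_kernel (p * s) 1 (h :: real ^ 'n) \<partial>lborel)
        \<le> magnetic_energy A s p u + B"
        unfolding B_def
      proof (rule magnetic_energy_lower_bound[OF p that])
        fix x y assume "g k x > 0" "g k y = 0"
        then have "cmod (u y) \<le> 1 / (real k + 1)" "g k x \<le> cmod (u x) - 1 / (real k + 1)"
          by (auto simp: g_def min_def max_def split: if_splits)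
        then show "g k x \<le> cmod (u x) - cmod (u y)" by linarith
      qed (auto simp: g0)
      then have "ennreal s * (2 * (?I * (\<integral>\<^sup>+ h. far_kernel (p * s) 1 (h :: real ^ 'n) \<partial>lborel)))
        \<le> ennreal s * (magnetic_energy A s p u + B)"
        by (intro mult_left_mono) (auto simp: mult.assoc)
      then show ?thesis
        using kern[of s 1 ?I] that by (simp add: distrib_left)
    qed
    \<comment> \<open>As \<open>s\<close> tends to 0, \<open>a + s * B\<close> tends to
      \<open>a\<close> and falls below \<open>c * ?I\<close>; with \<open>low\<close> this rules out
      that \<open>s\<close> times the energy is at most \<open>a\<close>. Arguing this way avoids
      subtraction in \<open>ennreal\<close>.\<close>
    show "eventually (\<lambda>s. a < ennreal s * magnetic_energy A s p u) (at_right 0)"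
      using order_tendstoD(2)[OF vanish[OF B, of a] k] eventually_at_right_less[of 0]
    proof eventually_elim
      case (elim s)
      show ?case
      proof (rule ccontr)
        assume "\<not> a < ennreal s * magnetic_energy A s p u"
        then have "ennreal s * magnetic_energy A s p u + ennreal s * B \<le> a + ennreal s * B"
          by (intro add_right_mono) simp
        with low[of s] elim show False
          by (meson leD le_less_trans)
      qed
    qed
  next
    fix a assume a: "ennreal c * I < a"
    \<comment> \<open>Otherwise \<open>c * I\<close> would be infinite, since \<open>c > 0\<close>,
      and nothing lies above it.\<close>
    have "I < \<infinity>"
      using a c by (cases I) (auto simp: ennreal_mult_top)
    then obtain i where i: "I = ennreal i" "i \<ge> 0" by (cases I) auto
    \<comment> \<open>Continuity at \<open>d = 0\<close> yields a \<open>d > 0\<close> for which the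
      leading term is still below \<open>a\<close>; only then is the radius \<open>k\<close>
      chosen.\<close>
    have "((\<lambda>d. ennreal (c * ((1 + d) powr p * i)))
      \<longlongrightarrow> ennreal (c * ((1 + 0) powr p * i))) (at_right 0)"
      by (intro tendsto_ennrealI tendsto_intros) auto
    moreover have "ennreal (c * ((1 + 0) powr p * i)) < a"
      using a c i by (simp add: ennreal_mult)
    ultimately have "eventually (\<lambda>d. ennreal (c * ((1 + d) powr p * i)) < a) (at_right 0)"
      by (rule order_tendstoD(2))
    then have "eventually (\<lambda>d::real. 0 < d \<and> ennreal (c * ((1 + d) powr p * i)) < a) (at_right 0)"
      using eventually_at_right_less[of 0] by eventually_elim simp
    then obtain d :: real where d: "0 < d" "ennreal (c * ((1 + d) powr p * i)) < a"
      using eventually_happens trivial_limit_at_right_real by blast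
    have d': "ennreal c * (ennreal ((1 + d) powr p) * I) < a"
      using d c i by (simp add: ennreal_mult)
    \<comment> \<open>The tail integral of the upper bound for \<open>R = k\<close>. It tends to 0
      by dominated convergence, with \<open>|u|^p\<close> as majorant.\<close>
    define W where "W k = (\<integral>\<^sup>+ x. ennreal (cmod (u x) powr p)
      * indicator {x. real k / 2 \<le> norm x} x \<partial>lborel)" for k :: nat
    have "W \<longlonglongrightarrow> (\<integral>\<^sup>+ (x :: real ^ 'n). 0 \<partial>lborel)"
      unfolding W_def[abs_def]
    proof (rule nn_integral_dominated_convergence[where w = "\<lambda>x. ennreal (cmod (u x) powr p)"])
      show "(\<integral>\<^sup>+ x. ennreal (cmod (u x) powr p) \<partial>lborel) < \<infinity>" using \<open>I < \<infinity>\<close> by (simp add: I_def)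
      show "AE x in lborel. (\<lambda>k. ennreal (cmod (u x) powr p) * indicator {x. real k / 2 \<le> norm x} x)
        \<longlonglongrightarrow> 0"
      proof (rule AE_I2)
        fix x :: "real ^ 'n"
        have "eventually (\<lambda>k. ennreal (cmod (u x) powr p) * indicator {x. real k / 2 \<le> norm x} x
          = 0) sequentially"
          using eventually_gt_at_top[of "nat \<lceil>2 * norm x\<rceil>"]
        proof eventually_elim
          case (elim k)
          then have "2 * norm x < real k" by linarith
          then show ?case by simp
        qed
        then show "(\<lambda>k. ennreal (cmod (u x) powr p) * indicator {x. real k / 2 \<le> norm x} x) \<longlonglongrightarrow> 0"
          by (rule tendsto_eventually)
      qed
    qed (auto split: split_indicator)
    then have "(\<lambda>k. ennreal c * (ennreal ((1 + d) powr p) * I + ennreal ((1 + 1 / d) powr p) * W k))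
      \<longlonglongrightarrow> ennreal c * (ennreal ((1 + d) powr p) * I + ennreal ((1 + 1 / d) powr p) * 0)"
      by (intro ennreal_tendsto_cmult tendsto_add tendsto_const) auto
    moreover have "ennreal c * (ennreal ((1 + d) powr p) * I + ennreal ((1 + 1 / d) powr p) * 0)
      < a"
      using d' by simp
    ultimately have "eventually (\<lambda>k. ennreal c
      * (ennreal ((1 + d) powr p) * I + ennreal ((1 + 1 / d) powr p) * W k) < a) sequentially"
      by (rule order_tendstoD(2))
    then have "eventually (\<lambda>k. 1
      \<le> k \<and> ennreal c * (ennreal ((1 + d) powr p) * I + ennreal ((1 + 1 / d) powr p) * W k)
      < a) sequentially"
      using eventually_ge_at_top[of 1] by eventually_elim simp
    then obtain k where k: "1 \<le> k"
      "ennreal c * (ennreal ((1 + d) powr p) * I + ennreal ((1 + 1 / d) powr p) * W k) < a"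
      by (auto dest: eventually_happens)
    define J where "J = ennreal ((1 + d) powr p) * I + ennreal ((1 + 1 / d) powr p) * W k"
    define B where "B = ennreal (real k powr (p * s0)) * magnetic_energy A s0 p u"
    have B: "B < \<infinity>" using s0 by (simp add: B_def ennreal_mult_less_top)
    have up: "ennreal s * magnetic_energy A s p u \<le> ennreal c * J + ennreal s * B"
      if s: "0 < s" "s \<le> s0" for s
    proof -
      have "magnetic_energy A s p u
        \<le> B + 2 * J * (\<integral>\<^sup>+ h. far_kernel (p * s) (real k) (h :: real ^ 'n) \<partial>lborel)"
        unfolding B_def J_def I_def W_def using p s d k
        by (intro magnetic_energy_upper_bound) auto
      then have "ennreal s * magnetic_energy A s p u
        \<le> ennreal s * (B + 2 * J * (\<integral>\<^sup>+ h. far_kernel (p * s) (real k) (h :: real ^ 'n) \<partial>lborel))"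
        by (intro mult_left_mono) auto
      also have "\<dots> = ennreal (c * real k powr - (p * s)) * J + ennreal s * B"
        using kern[of s "real k" J] s k by (simp add: distrib_left add.commute mult.assoc)
      also have "\<dots> \<le> ennreal c * J + ennreal s * B"
      proof (intro add_right_mono mult_right_mono ennreal_leI)
        have "real k powr - (p * s) \<le> real k powr 0"
          using k p s by (intro powr_mono) auto
        then show "c * real k powr - (p * s) \<le> c" using k c by simp
      qed simp
      finally show ?thesis .
    qed
    have "ennreal c * J < a" using k by (simp add: J_def)
    with vanish[OF B, of "ennreal c * J"] have "eventually (\<lambda>s. ennreal c * J + ennreal s * B
      < a) (at_right 0)"
      by (rule order_tendstoD(2))
    moreover have "eventually (\<lambda>s. s \<le> s0) (at_right (0::real))"
      using s0(1) by (auto simp: eventually_at_right_field intro!: exI[of _ s0])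
    ultimately show "eventually (\<lambda>s. ennreal s * magnetic_energy A s p u < a) (at_right 0)"
      using eventually_at_right_less[of 0]
    proof eventually_elim
      case (elim s)
      then show ?case by (intro le_less_trans[OF up])
    qed
  qed
  then show ?thesis by (simp add: c_def I_def)
qed

text \<open>By the Cauchy property the energies of \<open>f j - f N\<close> are at most 1, and
  Fatou's lemma along an almost everywhere convergent subsequence passes this on to
  \<open>u - f N\<close>; adding back the test function \<open>f N\<close> keeps the energy finite.
  Local boundedness is known for \<open>A\<close> and Borel measurability for \<open>A'\<close>, so
  the energies of the two fields are exchanged as required.\<close>

lemma magnetic_space_energy_finite:
  fixes A :: "real ^ 'n \<Rightarrow> real ^ 'n" and u :: "real ^ 'n \<Rightarrow> complex"
  assumes p: "1 \<le> p" and s: "0 < s" "s < 1" and bdd: "locally_bounded A"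
    and [measurable]: "A' \<in> borel_measurable borel" "u \<in> borel_measurable borel"
    and A': "AE x in lborel. A x = A' x"
    and f: "\<And>k. f k \<in> Cc_infinity" and lim: "tendsto_measure f u"
    and N: "\<And>j. j \<ge> N \<Longrightarrow> magnetic_norm A s p (\<lambda>x. f j x - f N x) < 1"
  shows "magnetic_energy A' s p u < \<infinity>"
proof -
  have [measurable]: "f k \<in> borel_measurable borel" for k
    using f by (rule Cc_infinity_measurable)
  have cong: "magnetic_energy A s p v = magnetic_energy A' s p v" for v
    using A' by (rule magnetic_energy_cong_AE) simp
  obtain r where r: "\<And>k::nat. k \<le> r k" "AE x in lborel. (\<lambda>k. f (r k) x) \<longlonglongrightarrow> u x"
    by (rule tendsto_measure_AE_subseq[of u f]) (use lim that in auto)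
  have "magnetic_energy A' s p (\<lambda>x. u x - f N x)
    \<le> liminf (\<lambda>k. magnetic_energy A' s p (\<lambda>x. f (r k) x - f N x))"
  proof (rule magnetic_energy_fatou[OF p])
    show "AE x in lborel. (\<lambda>k. f (r k) x - f N x) \<longlonglongrightarrow> u x - f N x"
      using r(2) by eventually_elim (intro tendsto_intros)
  qed measurable
  also have "\<dots> \<le> liminf (\<lambda>k. 1 :: ennreal)"
  proof (rule Liminf_mono)
    show "eventually (\<lambda>k. magnetic_energy A' s p (\<lambda>x. f (r k) x - f N x) \<le> 1) sequentially"
      using eventually_ge_at_top[of N]
    proof eventually_elim
      case (elim k)
      then have "N \<le> r k" using r(1)[of k] by linarith
      from N[OF this] show ?case
        unfolding magnetic_norm_def cong using p by (intro enn_powr_less_1_imp) auto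
    qed
  qed
  also have "\<dots> = 1" by (simp add: Liminf_const)
  finally have "magnetic_energy A' s p (\<lambda>x. u x - f N x) < \<infinity>"
    by (rule le_less_trans) simp
  moreover have "magnetic_energy A' s p (f N) < \<infinity>"
    using magnetic_energy_test_function_finite[OF f bdd p s, of N] by (simp add: cong)
  moreover have "magnetic_energy A' s p (\<lambda>x. (u x - f N x) + f N x)
    \<le> ennreal (2 * 2 powr p)
    * (magnetic_energy A' s p (\<lambda>x. u x - f N x) + magnetic_energy A' s p (f N))"
    by (rule magnetic_energy_add[OF p]) measurable
  ultimately show ?thesis
    by (auto simp: ennreal_mult_less_top intro: le_less_trans)
qed

section \<open>Passage to Borel representatives, and the constant\<close>

theorem theorem1p1:
  fixes A :: "real ^ 'n \<Rightarrow> real ^ 'n" and p :: real and u :: "real ^ 'n \<Rightarrow> complex"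
  assumes "1 \<le> p"
    and "A \<in> borel_measurable lebesgue"
    and "locally_bounded A"
    and "u \<in> (\<Union>s\<in>{0<..<1}. magnetic_space A s p)"
  shows "((\<lambda>s. ennreal s * magnetic_energy A s p u) \<longlongrightarrow>
           ennreal (4 * pi powr (real CARD('n) / 2) / (p * Gamma (real CARD('n) / 2)))
           * enn_powr (Lp_norm p u) p) (at_right 0)"
proof -
  obtain s0 where s0: "0 < s0" "s0 < 1" and space: "u \<in> magnetic_space A s0 p"
    using assms(4) by auto
  from space have u: "u \<in> borel_measurable lebesgue"
    by (simp add: magnetic_space_def)
  from space have "\<exists>f. (\<forall>k. f k \<in> Cc_infinity) \<and>
      (\<forall>e>0. \<exists>N. \<forall>j\<ge>N. \<forall>k\<ge>N. magnetic_norm A s0 p (\<lambda>x. f j x - f k x) < e) \<and> tendsto_measure f u"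
    unfolding magnetic_space_def mem_Collect_eq by (rule conjunct2)
  then obtain f where f': "\<forall>k. f k \<in> Cc_infinity"
    and cauchy: "\<forall>e>0. \<exists>N. \<forall>j\<ge>N. \<forall>k\<ge>N. magnetic_norm A s0 p (\<lambda>x. f j x - f k x) < e"
    and lim: "tendsto_measure f u"
    by (elim exE conjE)
  have f: "f k \<in> Cc_infinity" for k
    using f' by (rule spec)
  obtain A' where A': "A' \<in> borel_measurable borel" "AE x in lborel. A x = A' x"
    by (rule ex_borel_measurable_AE_eq_lebesgue[OF assms(2)]) (rule that)
  obtain u' where u': "u' \<in> borel_measurable borel" "AE x in lborel. u x = u' x"
    by (rule ex_borel_measurable_AE_eq_lebesgue[OF u]) (rule that)
  have lim': "tendsto_measure f u'"
    using u u' Cc_infinity_measurable[OF f] lim by (rule tendsto_measure_AE_cong)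
  obtain N where N: "\<And>j. j \<ge> N \<Longrightarrow> magnetic_norm A s0 p (\<lambda>x. f j x - f N x) < 1"
    using spec[OF cauchy, of 1] by auto
  have fin: "magnetic_energy A' s0 p u' < \<infinity>"
    by (rule magnetic_space_energy_finite[OF assms(1) s0 assms(3) A'(1) u'(1) A'(2) f lim' N])
  have energy: "magnetic_energy A s p u = magnetic_energy A' s p u'" for s
    using A'(2) u'(2) by (rule magnetic_energy_cong_AE)
  have "enn_powr (Lp_norm p u) p = (\<integral>\<^sup>+ x. ennreal (cmod (u x) powr p) \<partial>lborel)"
    using assms(1) by (simp add: Lp_norm_def enn_powr_inverse nn_integral_completion)
  also have "\<dots> = (\<integral>\<^sup>+ x. ennreal (cmod (u' x) powr p) \<partial>lborel)"
    by (rule nn_integral_cong_AE) (use u'(2) in eventually_elim, simp)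
  finally have norm: "enn_powr (Lp_norm p u) p = (\<integral>\<^sup>+ x. ennreal (cmod (u' x) powr p) \<partial>lborel)" .
  \<comment> \<open>The unit ball has volume \<open>pi powr (n / 2) / Gamma (n / 2 + 1)\<close>, so
    the recursion turns \<open>n\<close> times this volume into
    \<open>2 * pi powr (n / 2) / Gamma (n / 2)\<close>, the area of the sphere.\<close>
  have Gamma: "Gamma (real CARD('n) / 2 + 1) = real CARD('n) / 2 * Gamma (real CARD('n) / 2)"
    by (rule Gamma_plus1) (auto dest!: nonpos_Ints_nonpos simp: not_le)
  have "Gamma (real CARD('n) / 2) > 0"
    by (rule Gamma_real_pos) simp
  then have const: "4 * pi powr (real CARD('n) / 2) / (p * Gamma (real CARD('n) / 2))
    = 2 * (real CARD('n) * unit_ball_vol (real CARD('n))) / p"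
    unfolding unit_ball_vol_def Gamma by (simp add: field_simps)
  show ?thesis
    unfolding energy norm const
    using assms(1) A'(1) u'(1) s0(1) fin tendsto_measure_finite_level_sets[OF u'(1) f lim']
    by (rule magnetic_energy_borel_tendsto)
qed

end
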